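(* Let $m,n\ge 1$ be integers. The cone of $H_+(m)\otimes S_+(n)$-separable matrices in $\mathcal{H}(m)\otimes\mathcal{S}(n)$ coincides with the cone of positive semidefinite matrices in $\mathcal{H}(m)\otimes\mathcal{S}(n)$ if and only if $n\le 2$ or $m=1$ or $m+n\le 5$.
   Context: $\mathcal{S}(n)$ is the real vector space of real symmetric $n\times n$ matrices and $S_+(n)\subset\mathcal{S}(n)$ its cone of positive semidefinite (PSD) matrices; $\mathcal{H}(m)$ is the real vector space of complex hermitian $m\times m$ matrices and $H_+(m)$ its PSD cone. The (real) tensor product $\mathcal{H}(m)\otimes\mathcal{S}(n)$ is regarded as a subspace of $\mathcal{H}(mn)$ via the Kronecker product (matrices made of $m\times m$ blocks of size $n\times n$, $A\otimes B=(a_{\alpha\beta}B)$). A matrix is $H_+(m)\otimes S_+(n)$-separable if it is a finite sum $\sum_l A_l\otimes B_l$ with $A_l\in H_+(m)$, $B_l\in S_+(n)$. *)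

theory Defs
  imports "HOL-Analysis.Analysis"
begin

definition Sym :: "(real^'n^'n) set" where
  "Sym = {B. transpose B = B}"

definition Sym_psd :: "(real^'n^'n) set" where
  "Sym_psd = {B \<in> Sym. \<forall>x. 0 \<le> x \<bullet> (B *v x)}"

definition Herm :: "(complex^'m^'m) set" where
  "Herm = {A. \<forall>a b. A $ a $ b = cnj (A $ b $ a)}"

(* For hermitian A the quadratic form is real, so taking its real part loses nothing.
   The inner product of HOL-Analysis is not used: on complex vectors it is the real one. *)
definition Herm_psd :: "(complex^'m^'m) set" where
  "Herm_psd = {A \<in> Herm. \<forall>x. 0 \<le> Re (\<Sum>a\<in>UNIV. cnj (x $ a) * (A *v x) $ a)}"

(* Rows and columns of an mn x mn matrix are indexed by pairs (block index, index inside
   the block), so that the (a,b) block of kron A B is the scalar multiple A_ab B. *)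
definition kron :: "complex^'m^'m \<Rightarrow> real^'n^'n \<Rightarrow> complex^('m \<times> 'n)^('m \<times> 'n)" where
  "kron A B = (\<chi> p q. A $ fst p $ fst q * complex_of_real (B $ snd p $ snd q))"

(* The real tensor product of U and V, realised through the Kronecker product;
   span is the span over the reals. *)
definition tensor ::
  "(complex^'m^'m) set \<Rightarrow> (real^'n^'n) set \<Rightarrow> (complex^('m \<times> 'n)^('m \<times> 'n)) set" where
  "tensor U V = span {kron A B | A B. A \<in> U \<and> B \<in> V}"

definition separable ::
  "(complex^'m^'m) set \<Rightarrow> (real^'n^'n) set \<Rightarrow> complex^('m \<times> 'n)^('m \<times> 'n) \<Rightarrow> bool" where
  "separable P Q X \<longleftrightarrow>
     (\<exists>(k::nat) A B. (\<forall>l<k. A l \<in> P \<and> B l \<in> Q) \<and> X = (\<Sum>l<k. kron (A l) (B l)))"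

end

(* A product vector is z \<otimes> x with z complex and x real.
   Sufficiency: by Krein-Milman it is enough to treat extreme rays W of the cone of positive
   semidefinite matrices in the tensor space. If the range of W contains a product vector v, then
   W - c v v^* is still positive semidefinite for small c > 0, so W is a multiple of v v^*, which is
   separable. Product vectors are generalized eigenvectors. For n \<le> 2 one uses the pencil of the
   (hermitian) slices W(.,1;.,1), W(.,2;.,1). For m = 2, n = 3 with blocks A, X + iY, B one may assume A
   invertible; if the rank of W is at least 4, the 16-dimensional space of hermitian forms on a
   4-dimensional subspace of the range meets the trace zero part of the tensor space, which is cut out
   by 13 real conditions, and W is not extreme. Otherwise the Schur complement vanishes, so
   X A^-1 Y = Y A^-1 X, and X and Y have a common real eigenvector relative to A.
   Necessity: if W \<noteq> 0 is separable, some product vector is orthogonal to its kernel. For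
   m, n \<ge> 3 this fails when the kernel is spanned by the unextendible product basis "Tiles", and for
   m \<ge> 2, n \<ge> 4 it fails for an explicit sum of five squares. *)
theory Submission
  imports Defs
begin

section \<open>Rank-one matrices, product vectors and the complex inner product\<close>

definition outerc :: "complex^'k \<Rightarrow> complex^'k^'k" where
  "outerc v = (\<chi> p q. v $ p * cnj (v $ q))"

definition outerr :: "real^'k \<Rightarrow> real^'k^'k" where
  "outerr x = (\<chi> i j. x $ i * x $ j)"

definition pvec :: "complex^'m \<Rightarrow> real^'n \<Rightarrow> complex^('m \<times> 'n)" where
  "pvec z x = (\<chi> p. z $ fst p * of_real (x $ snd p))"

text \<open>Conjugate linear in the first argument, so that \<open>\<bullet>\<close> is its real
  part. Positivity is phrased with \<open>\<bullet>\<close>; \<open>cip\<close> serves where complex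
  orthogonality or a modulus is needed.\<close>

definition cip :: "complex^'k \<Rightarrow> complex^'k \<Rightarrow> complex" where
  "cip v f = (\<Sum>p\<in>UNIV. cnj (v $ p) * f $ p)"

lemma pvec_nth [simp]: "pvec z x $ (a, i) = z $ a * of_real (x $ i)"
  by (simp add: pvec_def)

lemma outerc_nth [simp]: "outerc v $ p $ q = v $ p * cnj (v $ q)"
  by (simp add: outerc_def)

lemma outerr_nth [simp]: "outerr x $ i $ j = x $ i * x $ j"
  by (simp add: outerr_def)

lemma kron_nth [simp]: "kron A B $ (a, i) $ (b, j) = A $ a $ b * of_real (B $ i $ j)"
  by (simp add: kron_def)

lemma sum_UNIV_prod:
  "(\<Sum>p\<in>UNIV. g (p :: 'a::finite \<times> 'b::finite)) = (\<Sum>a\<in>UNIV. \<Sum>i\<in>UNIV. g (a, i))"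
  unfolding UNIV_Times_UNIV[symmetric] by (subst sum.Sigma) auto

lemma Re_cip: "Re (cip v f) = v \<bullet> f"
  by (simp add: cip_def inner_vec_def inner_complex_def)

lemma Im_cip: "Im (cip v f) = - (v \<bullet> (\<i> *s f))"
  by (simp add: cip_def inner_vec_def inner_complex_def flip: sum_negf)

lemma cip_eq_0_iff: "cip v f = 0 \<longleftrightarrow> v \<bullet> f = 0 \<and> v \<bullet> (\<i> *s f) = 0"
  by (simp add: complex_eq_iff Re_cip Im_cip)

lemma outerc_mult: "outerc v *v f = cip v f *s v"
  by (simp add: vec_eq_iff matrix_vector_mult_def cip_def sum_distrib_left sum_distrib_right mult_ac)

lemma inner_outerc: "f \<bullet> (outerc v *v f) = (cmod (cip v f))\<^sup>2"
proof -
  have "f \<bullet> (cip v f *s v) = Re (cip f (cip v f *s v))" by (simp add: Re_cip)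
  also have "cip f (cip v f *s v) = cip v f * cnj (cip v f)"
    by (simp add: cip_def sum_distrib_left mult_ac)
  also have "Re \<dots> = (cmod (cip v f))\<^sup>2"
    by (metis Re_complex_of_real complex_norm_square)
  finally show ?thesis by (simp add: outerc_mult)
qed

lemma kron_outer: "kron (outerc z) (outerr x) = outerc (pvec z x)"
  by (simp add: vec_eq_iff mult_ac)

section \<open>Hermitian and positive semidefinite matrices\<close>

lemma Herm_iff: "A \<in> Herm \<longleftrightarrow> (\<forall>a b. cnj (A $ b $ a) = A $ a $ b)"
  unfolding Herm_def by (simp add: eq_commute)

lemma inner_mult_Herm:
  fixes W :: "complex^'k^'k"
  assumes "W \<in> Herm"
  shows "f \<bullet> (W *v g) = (W *v f) \<bullet> g"
proof -
  have "cip f (W *v g) = cip (W *v f) g"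
  proof -
    have "cip f (W *v g) = (\<Sum>p\<in>UNIV. \<Sum>q\<in>UNIV. cnj (f $ p) * W $ p $ q * g $ q)"
      by (simp add: cip_def matrix_vector_mult_def sum_distrib_left mult_ac)
    also have "\<dots> = (\<Sum>q\<in>UNIV. \<Sum>p\<in>UNIV. cnj (f $ p) * W $ p $ q * g $ q)"
      by (rule sum.swap)
    also have "\<dots> = (\<Sum>q\<in>UNIV. \<Sum>p\<in>UNIV. cnj (f $ p) * cnj (W $ q $ p) * g $ q)"
      using assms by (intro sum.cong refl) (metis Herm_iff)
    also have "\<dots> = cip (W *v f) g"
      by (simp add: cip_def matrix_vector_mult_def sum_distrib_left sum_distrib_right mult_ac)
    finally show ?thesis .
  qed
  then show ?thesis by (metis Re_cip)
qed

lemma Herm_psd_iff: "W \<in> Herm_psd \<longleftrightarrow> W \<in> Herm \<and> (\<forall>f. 0 \<le> f \<bullet> (W *v f))"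
  by (simp add: Herm_psd_def flip: cip_def Re_cip)

lemma Herm_psdD: "W \<in> Herm_psd \<Longrightarrow> W \<in> Herm" "W \<in> Herm_psd \<Longrightarrow> 0 \<le> f \<bullet> (W *v f)"
  by (auto simp: Herm_psd_iff)

lemma outerc_Herm: "outerc v \<in> Herm"
  by (simp add: Herm_iff)

lemma outerc_psd: "outerc v \<in> Herm_psd"
  by (simp add: Herm_psd_iff outerc_Herm inner_outerc)

lemma outerr_Sym: "outerr x \<in> Sym"
  by (simp add: Sym_def transpose_def vec_eq_iff)

lemma inner_outerr: "y \<bullet> (outerr x *v y) = (x \<bullet> y)\<^sup>2"
  by (simp add: inner_vec_def matrix_vector_mult_def power2_eq_square sum_product sum_distrib_left mult_ac)

lemma outerr_psd: "outerr x \<in> Sym_psd"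
  by (simp add: Sym_psd_def outerr_Sym inner_outerr)

text \<open>The quadratic polynomial in \<open>t\<close> given by the form at
  \<open>f + t *\<^sub>R g\<close> is nonnegative. Positivity is asked on a subspace
  \<open>E\<close> only, because \<open>generalized_eigenvector\<close> applies this to an operator
  that is known to be nonnegative just there.\<close>

lemma cauchy_schwarz_form:
  fixes S :: "'a::real_inner \<Rightarrow> 'a"
  assumes lin: "linear S" and adj: "\<And>f g. f \<bullet> S g = S f \<bullet> g"
    and E: "subspace E" and pos: "\<And>f. f \<in> E \<Longrightarrow> 0 \<le> f \<bullet> S f"
    and fg: "f \<in> E" "g \<in> E"
  shows "(f \<bullet> S g)\<^sup>2 \<le> (f \<bullet> S f) * (g \<bullet> S g)"
proof -
  have sym: "f \<bullet> S g = g \<bullet> S f" by (metis adj inner_commute)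
  have *: "0 \<le> f \<bullet> S f + 2 * t * (f \<bullet> S g) + t^2 * (g \<bullet> S g)" for t :: real
  proof -
    have "0 \<le> (f + t *\<^sub>R g) \<bullet> S (f + t *\<^sub>R g)" 
      by (intro pos subspace_add subspace_scale E fg)
    also have "\<dots> = f \<bullet> S f + 2 * t * (f \<bullet> S g) + t^2 * (g \<bullet> S g)"
      using sym by (simp add: linear_add[OF lin] linear_scale[OF lin] inner_add_left inner_add_right
          power2_eq_square algebra_simps)
    finally show ?thesis .
  qed
  show ?thesis
  proof (cases "g \<bullet> S g = 0")
    case True
    have "f \<bullet> S g = 0"
    proof (rule ccontr)
      assume n: "f \<bullet> S g \<noteq> 0"
      \<comment> \<open>This value of \<open>t\<close> makes the right-hand side equal to
        -1.\<close>
      have "0 \<le> f \<bullet> S f + 2 * (-(f \<bullet> S f + 1) / (2 * (f \<bullet> S g))) * (f \<bullet> S g)"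
        using *[of "-(f \<bullet> S f + 1) / (2 * (f \<bullet> S g))"] True by simp
      with n show False by (simp add: field_simps)
    qed
    then show ?thesis using True by simp
  next
    case False
    then have gp: "g \<bullet> S g > 0" using pos[OF fg(2)] by simp
    have "0 \<le> f \<bullet> S f - (f \<bullet> S g)\<^sup>2 / (g \<bullet> S g)"
      using *[of "-(f \<bullet> S g) / (g \<bullet> S g)"] gp by (simp add: power2_eq_square field_simps)
    with gp show ?thesis by (simp add: field_simps)
  qed
qed

lemma psd_cauchy_schwarz:
  assumes "W \<in> Herm_psd"
  shows "(f \<bullet> (W *v g))\<^sup>2 \<le> (f \<bullet> (W *v f)) * (g \<bullet> (W *v g))"
  using assms by (intro cauchy_schwarz_form[where E = UNIV]) (auto simp: Herm_psd_iff inner_mult_Herm)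

text \<open>Cauchy-Schwarz with \<open>W *v f\<close> as the second vector bounds the norm of
  \<open>W *v f\<close> by 0.\<close>

lemma psd_kernel:
  assumes W: "W \<in> Herm_psd" and 0: "f \<bullet> (W *v f) = 0"
  shows "W *v f = 0"
proof -
  have "((W *v f) \<bullet> (W *v f))\<^sup>2 \<le> 0"
    using psd_cauchy_schwarz[OF W, of "W *v f" f] 0 by simp
  then show ?thesis by simp
qed

lemma subspace_Herm: "subspace Herm"
  by (simp add: subspace_def Herm_iff)

lemma psd_add: "V \<in> Herm_psd \<Longrightarrow> W \<in> Herm_psd \<Longrightarrow> V + W \<in> Herm_psd"
  by (simp add: subspace_add[OF subspace_Herm] Herm_psd_iff matrix_vector_mult_add_rdistrib inner_add_right)

lemma scaleR_matrix_vector: "(c *\<^sub>R W) *v f = c *\<^sub>R (W *v (f::complex^'k))"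
  by (simp add: vec_eq_iff matrix_vector_mult_def scaleR_sum_right)

lemma psd_scale: "W \<in> Herm_psd \<Longrightarrow> 0 \<le> c \<Longrightarrow> c *\<^sub>R W \<in> Herm_psd"
  by (simp add: subspace_scale[OF subspace_Herm] Herm_psd_iff scaleR_matrix_vector)

lemma psd_0: "0 \<in> Herm_psd"
  by (simp add: Herm_psd_iff Herm_iff)

lemma psd_sum: "(\<And>l. l \<in> I \<Longrightarrow> F l \<in> Herm_psd) \<Longrightarrow> sum F I \<in> Herm_psd"
  by (induction I rule: infinite_finite_induct) (auto intro: psd_add psd_0)

section \<open>The tensor space inside the hermitian matrices\<close>

lemma subspace_tensor: "subspace (tensor U V)"
  by (simp add: tensor_def)

lemma kron_in_tensor: "A \<in> U \<Longrightarrow> B \<in> V \<Longrightarrow> kron A B \<in> tensor U V"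
  unfolding tensor_def by (rule span_base) blast

text \<open>The second condition is invariance under transposition of the real factor. Conversely,
  such a \<open>W\<close> is the sum of its slices \<open>Wij i j\<close> tensored with symmetrised
  matrix units; the invariance makes each slice hermitian.\<close>

lemma tensor_iff:
  fixes W :: "complex^('m::finite \<times> 'n::finite)^('m \<times> 'n)"
  shows "W \<in> tensor Herm Sym \<longleftrightarrow>
    W \<in> Herm \<and> (\<forall>a b i j. W $ (a,i) $ (b,j) = W $ (a,j) $ (b,i))"
proof
  have sub: "subspace {W::complex^('m \<times> 'n)^('m \<times> 'n). W \<in> Herm \<and>
      (\<forall>a b i j. W $ (a,i) $ (b,j) = W $ (a,j) $ (b,i))}" (is "subspace ?T")
    unfolding subspace_def using subspace_Herm by (auto simp: subspace_def)
  have "kron A B \<in> ?T" if "A \<in> Herm" "B \<in> Sym" for A and B :: "real^'n^'n"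
  proof -
    have B: "B $ i $ j = B $ j $ i" for i j
      using that(2) by (metis (mono_tags, lifting) Sym_def mem_Collect_eq transpose_def vec_lambda_beta)
    have A: "cnj (A $ b $ a) = A $ a $ b" for a b using that(1) by (metis Herm_iff)
    show ?thesis unfolding Herm_iff mem_Collect_eq by (auto simp: A B)
  qed
  then have "tensor Herm Sym \<subseteq> ?T" unfolding tensor_def by (intro span_minimal sub) blast
  then show "W \<in> tensor Herm Sym \<Longrightarrow> W \<in> Herm \<and> (\<forall>a b i j. W $ (a,i) $ (b,j) = W $ (a,j) $ (b,i))"
    by blast
next
  assume "W \<in> Herm \<and> (\<forall>a b i j. W $ (a,i) $ (b,j) = W $ (a,j) $ (b,i))"
  then have h: "\<And>p q. cnj (W $ q $ p) = W $ p $ q" and t: "\<And>a b i j. W $ (a,i) $ (b,j) = W $ (a,j) $ (b,i)"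
    by (auto simp: Herm_iff)
  define Wij where "Wij i j = (\<chi> a b. W $ (a,i) $ (b,j))" for i j
  \<comment> \<open>With the weights 1/2 the sum can run over all ordered pairs; for
    \<open>i = j\<close> the two terms add up to the diagonal unit.\<close>
  define E :: "'n \<Rightarrow> 'n \<Rightarrow> real^'n^'n" where
    "E i j = (\<chi> k l. (if k = i \<and> l = j then 1/2 else 0) + (if k = j \<and> l = i then 1/2 else 0))" for i j
  have WH: "Wij i j \<in> Herm" for i j
    unfolding Herm_iff Wij_def vec_lambda_beta h by (auto intro: t)
  have ES: "E i j \<in> Sym" for i j
    by (simp add: E_def Sym_def transpose_def vec_eq_iff conj_commute add.commute)
  have "W = (\<Sum>i\<in>UNIV. \<Sum>j\<in>UNIV. kron (Wij i j) (E i j))"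
  proof -
    have "W $ (a,k) $ (b,l) = (\<Sum>i\<in>UNIV. \<Sum>j\<in>UNIV. kron (Wij i j) (E i j)) $ (a,k) $ (b,l)" for a b k l
    proof -
      have eq: "kron (Wij i j) (E i j) $ (a,k) $ (b,l)
         = (if j = l then if i = k then W $ (a,i) $ (b,j) / 2 else 0 else 0)
         + (if j = k then if i = l then W $ (a,i) $ (b,j) / 2 else 0 else 0)" for i j
        by (auto simp: E_def Wij_def)
      show ?thesis
        by (simp only: sum_component eq sum.distrib sum.delta finite UNIV_I if_True) (simp add: t[of a l b k])
    qed
    then show ?thesis by (auto simp: vec_eq_iff)
  qed
  also have "\<dots> \<in> tensor Herm Sym"
    by (intro subspace_sum subspace_tensor kron_in_tensor WH ES)
  finally show "W \<in> tensor Herm Sym" .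
qed

lemma outerc_pvec_tensor: "outerc (pvec z x) \<in> tensor Herm Sym"
  by (metis kron_outer kron_in_tensor outerc_Herm outerr_Sym)

section \<open>Reduction to extreme rays\<close>

lemma inner_ii: "(\<i> *s f) \<bullet> (\<i> *s g) = f \<bullet> (g::complex^'k)"
  by (simp add: inner_vec_def inner_complex_def add.commute)

lemma mult_vector_smult: "W *v (c *s f) = c *s (W *v (f::complex^'k))"
  by (simp add: vec_eq_iff matrix_vector_mult_def sum_distrib_left mult_ac)

text \<open>The real inequality for \<open>g\<close> and for \<open>\<i> *s g\<close> controls the
  real and the imaginary part of \<open>cip\<close>; adding the two costs the factor 2.\<close>

lemma psd_cip_cauchy_schwarz:
  assumes W: "W \<in> Herm_psd"
  shows "(cmod (cip (W *v f) g))\<^sup>2 \<le> 2 * (f \<bullet> (W *v f)) * (g \<bullet> (W *v g))"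
proof -
  have b: "((W *v f) \<bullet> g)\<^sup>2 \<le> (f \<bullet> (W *v f)) * (g \<bullet> (W *v g))" for g
    using psd_cauchy_schwarz[OF W, of g f] by (simp add: inner_commute mult.commute)
  have "(cmod (cip (W *v f) g))\<^sup>2 = ((W *v f) \<bullet> g)\<^sup>2 + ((W *v f) \<bullet> (\<i> *s g))\<^sup>2"
    by (simp add: cmod_def Re_cip Im_cip)
  also have "\<dots> \<le> 2 * (f \<bullet> (W *v f)) * (g \<bullet> (W *v g))"
    using b[of g] b[of "\<i> *s g"] by (simp add: mult_vector_smult inner_ii)
  finally show ?thesis .
qed

text \<open>If \<open>q\<close> is the form of \<open>W\<close> at \<open>f\<close>, then the
  squared modulus of \<open>cip v g\<close> is at most \<open>2 * q\<close> times the form at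
  \<open>g\<close>, so \<open>c = 1/(2*q)\<close> is small enough.\<close>

lemma psd_minus_range:
  assumes W: "W \<in> Herm_psd" and v: "W *v f = v" "v \<noteq> 0"
  shows "\<exists>c>0. W - c *\<^sub>R outerc v \<in> Herm_psd"
proof -
  define q where "q = f \<bullet> (W *v f)"
  have q: "q > 0"
    using psd_kernel[OF W, of f] v Herm_psdD(2)[OF W, of f] unfolding q_def by fastforce
  have "0 \<le> g \<bullet> ((W - (1/(2*q)) *\<^sub>R outerc v) *v g)" for g
    using psd_cip_cauchy_schwarz[OF W, of f g] q unfolding v(1) q_def[symmetric, unfolded v(1)]
    by (simp add: matrix_vector_mult_diff_rdistrib scaleR_matrix_vector inner_diff_right inner_outerc field_simps)
  moreover have "W - (1/(2*q)) *\<^sub>R outerc v \<in> Herm"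
    using W by (intro subspace_diff[OF subspace_Herm] subspace_scale[OF subspace_Herm] outerc_Herm Herm_psdD)
  ultimately show ?thesis using q by (intro exI[of _ "1/(2*q)"]) (auto simp: Herm_psd_iff)
qed

text \<open>Cuts a compact base out of the cone: it is positive on nonzero PSD matrices and bounds
  their norm.\<close>

definition rtrace :: "complex^'k^'k \<Rightarrow> real" where
  "rtrace W = (\<Sum>p\<in>UNIV. Re (W $ p $ p))"

lemma linear_rtrace: "linear rtrace"
  by (auto simp: linear_iff rtrace_def sum.distrib sum_distrib_left)

lemma mult_axis: "(W *v axis q u) $ p = W $ p $ q * (u::complex)"
proof -
  have "(W *v axis q u) $ p = (\<Sum>r\<in>UNIV. if r = q then W $ p $ r * u else 0)"
    by (simp add: matrix_vector_mult_def axis_def if_distrib cong: if_cong)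
  then show ?thesis by simp
qed

lemma inner_axis_mult: "axis p u \<bullet> (W *v axis q v) = Re (cnj u * W $ p $ q * (v::complex))"
  by (simp add: inner_axis' mult_axis inner_complex_def algebra_simps)

lemma psd_diag_nonneg: "W \<in> Herm_psd \<Longrightarrow> 0 \<le> Re (W $ p $ p)"
  using Herm_psdD(2)[of W "axis p 1"] by (simp add: inner_axis_mult)

lemma psd_diag_le_rtrace: "W \<in> Herm_psd \<Longrightarrow> Re (W $ p $ p) \<le> rtrace W"
  unfolding rtrace_def by (rule member_le_sum) (auto intro: psd_diag_nonneg)

text \<open>Cauchy-Schwarz for two basis vectors, the first multiplied by a phase \<open>u\<close>:
  \<open>u = 1\<close> yields the real part of the entry and \<open>u = \<i>\<close> the imaginary
  part.\<close>

lemma psd_entry_le_rtrace: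
  assumes W: "W \<in> Herm_psd"
  shows "cmod (W $ p $ q) \<le> 2 * rtrace W"
proof -
  have t: "0 \<le> rtrace W" unfolding rtrace_def by (intro sum_nonneg psd_diag_nonneg W)
  have b: "(Re (cnj u * W $ p $ q))\<^sup>2 \<le> (rtrace W)\<^sup>2" if "cmod u = 1" for u
  proof -
    have "cnj u * W $ p $ p * u = (cnj u * u) * W $ p $ p" by simp
    also have "cnj u * u = 1" using that by (metis complex_norm_square mult.commute of_real_1 one_power2)
    finally have u: "cnj u * W $ p $ p * u = W $ p $ p" by simp
    have "(axis p u \<bullet> (W *v axis q 1))\<^sup>2 \<le> (axis p u \<bullet> (W *v axis p u)) * (axis q 1 \<bullet> (W *v axis q 1))"
      by (rule psd_cauchy_schwarz[OF W])
    also have "\<dots> \<le> rtrace W * rtrace W"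
      unfolding inner_axis_mult u
      using psd_diag_nonneg[OF W] psd_diag_le_rtrace[OF W] t by (intro mult_mono) auto
    finally show ?thesis by (simp add: inner_axis_mult power2_eq_square)
  qed
  have "\<bar>Re (W $ p $ q)\<bar> \<le> rtrace W" using b[of 1] t by (simp add: abs_le_square_iff[symmetric])
  moreover have "\<bar>Im (W $ p $ q)\<bar> \<le> rtrace W" using b[of \<i>] t by (simp add: abs_le_square_iff[symmetric])
  ultimately show ?thesis using cmod_le[of "W $ p $ q"] by linarith
qed

lemma psd_norm_le_rtrace:
  assumes W: "(W::complex^'k^'k) \<in> Herm_psd"
  shows "norm W \<le> (2 * real CARD('k) * real CARD('k)) * rtrace W"
proof -
  have "norm (W $ p) \<le> real CARD('k) * (2 * rtrace W)" for p
  proof -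
    have "norm (W $ p) \<le> (\<Sum>q\<in>UNIV. norm (W $ p $ q))"
      unfolding norm_vec_def by (rule L2_set_le_sum) simp
    also have "\<dots> \<le> (\<Sum>q\<in>(UNIV::'k set). 2 * rtrace W)"
      by (intro sum_mono psd_entry_le_rtrace W)
    finally show ?thesis by simp
  qed
  then have "(\<Sum>p\<in>UNIV. norm (W $ p)) \<le> (\<Sum>p\<in>(UNIV::'k set). real CARD('k) * (2 * rtrace W))"
    by (intro sum_mono)
  moreover have "norm W \<le> (\<Sum>p\<in>UNIV. norm (W $ p))"
    unfolding norm_vec_def[of W] by (rule L2_set_le_sum) simp
  ultimately show ?thesis by (simp add: mult_ac)
qed

lemma rtrace_pos: "W \<in> Herm_psd \<Longrightarrow> W \<noteq> 0 \<Longrightarrow> 0 < rtrace W"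
  using psd_norm_le_rtrace[of W] by (smt (verit) mult_nonneg_nonpos of_nat_0_le_iff zero_less_norm_iff mult_nonneg_nonneg)

lemma closed_psd: "closed (Herm_psd :: (complex^'k^'k) set)"
proof -
  have eq: "Herm_psd = Herm \<inter> {W :: complex^'k^'k. \<forall>f. 0 \<le> f \<bullet> (W *v f)}"
    by (auto simp: Herm_psd_iff)
  have "closed {W :: complex^'k^'k. \<forall>f. 0 \<le> f \<bullet> (W *v f)}"
    unfolding inner_vec_def matrix_vector_mult_def
    by (intro closed_Collect_all closed_Collect_le continuous_intros)
  then show ?thesis unfolding eq by (intro closed_Int closed_subspace[OF subspace_Herm])
qed

text \<open>The elements of trace 1 form a compact convex set, which by Krein-Milman is the hull of
  its extreme points, and \<open>range\<close> forces each of these to be a multiple of some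
  \<open>outerc (pvec z x)\<close>. A general predicate \<open>P\<close> lets the principle serve
  both for separability and for \<open>kron_psd\<close>.\<close>

lemma psd_tensor_cone_induct:
  fixes X :: "complex^('m::finite \<times> 'n::finite)^('m \<times> 'n)"
  assumes X: "X \<in> tensor Herm Sym" "X \<in> Herm_psd"
    and outer: "\<And>z x. P (outerc (pvec z x))"
    and add: "\<And>U V. P U \<Longrightarrow> P V \<Longrightarrow> P (U + V)"
    and scale: "\<And>c U. 0 \<le> c \<Longrightarrow> P U \<Longrightarrow> P (c *\<^sub>R U)"
    and range: "\<And>W :: complex^('m \<times> 'n)^('m \<times> 'n).
      W \<in> tensor Herm Sym \<Longrightarrow> W \<in> Herm_psd \<Longrightarrow> W \<noteq> 0 \<Longrightarrow>
      (\<And>H. H \<in> tensor Herm Sym \<Longrightarrow> W + H \<in> Herm_psd \<Longrightarrow> W - H \<in> Herm_psd \<Longrightarrow> \<exists>c. H = c *\<^sub>R W) \<Longrightarrow>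
      \<exists>z x f. pvec z x \<noteq> 0 \<and> W *v f = pvec z x"
  shows "P X"
proof -
  define K :: "(complex^('m \<times> 'n)^('m \<times> 'n)) set" where
    "K = tensor Herm Sym \<inter> Herm_psd \<inter> {W. rtrace W = 1}"
  have tr_add: "rtrace (U + V) = rtrace U + rtrace V"
    and tr_diff: "rtrace (U - V) = rtrace U - rtrace V"
    and tr_scale: "rtrace (c *\<^sub>R U) = c * rtrace U" for U V :: "complex^('m \<times> 'n)^('m \<times> 'n)" and c
    by (simp_all add: linear_add linear_diff linear_scale linear_rtrace)
  have "bounded K"
    unfolding bounded_iff K_def using psd_norm_le_rtrace by fastforce
  moreover have "closed K"
  proof -
    have "closed {W::complex^('m \<times> 'n)^('m \<times> 'n). rtrace W = 1}"
      unfolding rtrace_def by (intro closed_Collect_eq continuous_intros)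
    then show ?thesis unfolding K_def
      by (intro closed_Int closed_psd closed_subspace[OF subspace_tensor])
  qed
  ultimately have comp: "compact K" by (simp add: compact_eq_bounded_closed)
  have conv: "convex K"
    unfolding convex_def K_def
    by (auto intro!: psd_add psd_scale subspace_add[OF subspace_tensor] subspace_scale[OF subspace_tensor]
        simp: tr_add tr_scale)
  have KM: "K = convex hull {x. x extreme_point_of K}"
    by (rule Krein_Milman_Minkowski[OF comp conv])
  have ext: "P W" if W: "W extreme_point_of K" for W
  proof -
    have WK: "W \<in> K" and noseg: "\<And>a b. a \<in> K \<Longrightarrow> b \<in> K \<Longrightarrow> W \<notin> open_segment a b"
      using W by (auto simp: extreme_point_of_def)
    have Wt: "W \<in> tensor Herm Sym" and Wp: "W \<in> Herm_psd" and Wtr: "rtrace W = 1"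
      using WK by (auto simp: K_def)
    have W0: "W \<noteq> 0" using Wtr by (auto simp: rtrace_def)
    \<comment> \<open>An extreme point of \<open>K\<close> spans an extreme ray: rescaled to trace
      1, \<open>W + H\<close> and \<open>W - H\<close> become points \<open>a\<close> and
      \<open>b\<close> of \<open>K\<close> with \<open>W\<close> between them.\<close>
    have extr: "\<exists>c. H = c *\<^sub>R W"
      if H: "H \<in> tensor Herm Sym" "W + H \<in> Herm_psd" "W - H \<in> Herm_psd" for H
    proof -
      define t where "t = rtrace H"
      consider "W + H = 0" | "W - H = 0" | "W + H \<noteq> 0" "W - H \<noteq> 0" by blast
      then show ?thesis
      proof cases
        case 1 then show ?thesis by (intro exI[of _ "-1"]) (simp add: add_eq_0_iff)
      next
        case 2 then show ?thesis by (intro exI[of _ 1]) simp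
      next
        case 3
        have t1: "1 + t > 0" "1 - t > 0"
          using rtrace_pos[OF H(2) 3(1)] rtrace_pos[OF H(3) 3(2)] by (auto simp: t_def tr_add tr_diff Wtr)
        define a where "a = (1/(1+t)) *\<^sub>R (W + H)"
        define b where "b = (1/(1-t)) *\<^sub>R (W - H)"
        have aK: "a \<in> K" and bK: "b \<in> K"
          using t1 H Wt unfolding K_def a_def b_def
          by (auto intro!: psd_scale subspace_scale[OF subspace_tensor] subspace_add[OF subspace_tensor]
              subspace_diff[OF subspace_tensor] simp: tr_scale tr_add tr_diff Wtr t_def[symmetric])
        have "W = (1 - (1-t)/2) *\<^sub>R a + ((1-t)/2) *\<^sub>R b"
        proof -
          have "(1 - (1-t)/2) *\<^sub>R a = (1/2) *\<^sub>R (W + H)" using t1 by (simp add: a_def field_simps)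
          moreover have "((1-t)/2) *\<^sub>R b = (1/2) *\<^sub>R (W - H)" using t1 by (simp add: b_def)
          ultimately show ?thesis by (simp add: scaleR_add_right[symmetric] scaleR_2[symmetric])
        qed
        moreover have "0 < (1-t)/2" "(1-t)/2 < 1" using t1 by auto
        ultimately have "a = b"
          using noseg[OF aK bK] unfolding in_segment by blast
        then have "W = a"
          using \<open>W = (1 - (1-t)/2) *\<^sub>R a + ((1-t)/2) *\<^sub>R b\<close>
          by (metis diff_add_cancel scaleR_left.add scaleR_one)
        moreover have "(1 + t) *\<^sub>R a = W + H" using t1 by (simp add: a_def)
        ultimately have "(1 + t) *\<^sub>R W = W + H" by simp
        then have "H = t *\<^sub>R W" by (simp add: scaleR_add_left)
        then show ?thesis by blast
      qed
    qed
    obtain z x f where zx: "pvec z x \<noteq> 0" "W *v f = pvec z x"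
      using range[OF Wt Wp W0 extr] by blast
    obtain c where c: "c > 0" "W - c *\<^sub>R outerc (pvec z x) \<in> Herm_psd"
      using psd_minus_range[OF Wp zx(2,1)] by blast
    \<comment> \<open>Extremality with \<open>H\<close> the subtracted multiple of the rank-one
      matrix: \<open>W + H\<close> is a sum of PSD matrices, and \<open>W - H\<close> is PSD by the
      choice of \<open>c\<close>.\<close>
    have "\<exists>d. c *\<^sub>R outerc (pvec z x) = d *\<^sub>R W"
      using c Wp by (intro extr psd_add psd_scale outerc_psd subspace_scale[OF subspace_tensor] outerc_pvec_tensor) auto
    then obtain d where d: "c *\<^sub>R outerc (pvec z x) = d *\<^sub>R W" by blast
    have "outerc (pvec z x) \<noteq> 0"
    proof
      assume "outerc (pvec z x) = 0"
      then have "outerc (pvec z x) $ p $ p = 0" for p by simp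
      then show False using zx(1) by (auto simp: vec_eq_iff simp del: pvec_nth)
    qed
    then have "0 < rtrace (c *\<^sub>R outerc (pvec z x))"
      using c(1) by (simp add: tr_scale rtrace_pos outerc_psd)
    then have dpos: "d > 0" unfolding d tr_scale Wtr by simp
    have "(1/d) *\<^sub>R (c *\<^sub>R outerc (pvec z x)) = (1/d) *\<^sub>R (d *\<^sub>R W)"
      unfolding d ..
    then have "W = (c/d) *\<^sub>R outerc (pvec z x)" using dpos by simp
    moreover have "P ((c/d) *\<^sub>R outerc (pvec z x))" using c dpos by (intro scale outer) simp
    ultimately show ?thesis by simp
  qed
  have "convex {U. P U}" unfolding convex_def using add scale by blast
  then have "convex hull {x. x extreme_point_of K} \<subseteq> {U. P U}"
    using ext by (intro hull_minimal) auto
  then have PK: "P U" if "U \<in> K" for U using KM that by blast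
  show ?thesis
  proof (cases "X = 0")
    case True
    then show ?thesis using scale[of 0, OF _ outer] by simp
  next
    case False
    have pos: "rtrace X > 0" using rtrace_pos[OF X(2) False] .
    have "(1 / rtrace X) *\<^sub>R X \<in> K"
      using X pos unfolding K_def by (auto intro!: psd_scale subspace_scale[OF subspace_tensor] simp: tr_scale)
    from scale[OF _ PK[OF this], of "rtrace X"] pos show ?thesis by simp
  qed
qed

section \<open>Product vectors in ranges\<close>

text \<open>Let \<open>x\<close> maximise the Rayleigh quotient on the unit sphere of
  \<open>E\<close>, with maximum \<open>\<nu>\<close>. Then \<open>\<nu> *\<^sub>R S - T\<close> is
  nonnegative on \<open>E\<close> and its form vanishes at \<open>x\<close>, so Cauchy-Schwarz
  applies. The equation is tested against \<open>E\<close> only, since the operators need not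
  preserve \<open>E\<close>.\<close>

lemma generalized_eigenvector:
  fixes S T :: "'a::euclidean_space \<Rightarrow> 'a"
  assumes S: "linear S" "\<And>f g. f \<bullet> S g = S f \<bullet> g"
    and T: "linear T" "\<And>f g. f \<bullet> T g = T f \<bullet> g"
    and E: "subspace E" "E \<noteq> {0}"
    and pos: "\<And>x. x \<in> E \<Longrightarrow> x \<noteq> 0 \<Longrightarrow> 0 < x \<bullet> S x"
  shows "\<exists>x\<in>E. \<exists>\<nu>. x \<noteq> 0 \<and> (\<forall>e\<in>E. e \<bullet> T x = \<nu> * (e \<bullet> S x))"
proof -
  define C where "C = E \<inter> sphere 0 1"
  obtain y where y: "y \<in> E" "y \<noteq> 0" using E subspace_0 by blast
  have "(1 / norm y) *\<^sub>R y \<in> C" using y E by (simp add: C_def subspace_scale)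
  then have ne: "C \<noteq> {}" by blast
  have comp: "compact C" unfolding C_def by (intro closed_Int_compact closed_subspace E compact_sphere)
  have contS: "continuous_on C S" and contT: "continuous_on C T"
    using S(1) T(1) by (simp_all add: linear_continuous_on linear_conv_bounded_linear)
  have nz: "x \<bullet> S x \<noteq> 0" if "x \<in> C" for x using pos[of x] that unfolding C_def by force
  have "continuous_on C (\<lambda>x. (x \<bullet> T x) / (x \<bullet> S x))"
    using nz by (intro continuous_intros contS contT) blast
  from continuous_attains_sup[OF comp ne this]
  obtain x where x: "x \<in> C" and max: "\<And>y. y \<in> C \<Longrightarrow> (y \<bullet> T y) / (y \<bullet> S y) \<le> (x \<bullet> T x) / (x \<bullet> S x)"
    by blast
  define \<nu> where "\<nu> = (x \<bullet> T x) / (x \<bullet> S x)"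
  define R where "R z = \<nu> *\<^sub>R S z - T z" for z
  have xE: "x \<in> E" and x0: "x \<noteq> 0" using x by (auto simp: C_def)
  have linR: "linear R" unfolding R_def
    by (intro linear_compose_sub linear_compose_scale_right S T)
  have adjR: "f \<bullet> R g = R f \<bullet> g" for f g
    by (simp add: R_def inner_diff_left inner_diff_right S(2) T(2))
  have posR: "0 \<le> f \<bullet> R f" if f: "f \<in> E" for f
  proof (cases "f = 0")
    case False
    have fC: "(1 / norm f) *\<^sub>R f \<in> C" using f False E by (simp add: C_def subspace_scale)
    have "(f \<bullet> T f) / (f \<bullet> S f) \<le> \<nu>"
      using max[OF fC] False unfolding \<nu>_def by (simp add: linear_scale S(1) T(1))
    then show ?thesis
      using pos[OF f False] by (simp add: R_def inner_diff_right field_simps)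
  qed (use linear_0[OF linR] in simp)
  have "x \<bullet> R x = 0" using nz[OF x] by (simp add: R_def inner_diff_right \<nu>_def)
  have "e \<bullet> T x = \<nu> * (e \<bullet> S x)" if "e \<in> E" for e
  proof -
    have "(e \<bullet> R x)\<^sup>2 \<le> (e \<bullet> R e) * (x \<bullet> R x)"
      by (rule cauchy_schwarz_form[OF linR adjR E(1) posR that xE])
    then have "e \<bullet> R x = 0" using \<open>x \<bullet> R x = 0\<close> by simp
    then show ?thesis by (simp add: R_def inner_diff_right)
  qed
  then show ?thesis using xE x0 by blast
qed

text \<open>For fixed \<open>e\<close> this is the adjoint of the map from \<open>y\<close> to
  \<open>pvec y e\<close>, see \<open>inner_pvec\<close>.\<close>

definition contract :: "real^'n \<Rightarrow> complex^('m \<times> 'n) \<Rightarrow> complex^'m" where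
  "contract e g = (\<chi> a. \<Sum>i\<in>UNIV. of_real (e $ i) * g $ (a, i))"

lemma inner_pvec: "pvec y e \<bullet> g = y \<bullet> contract e g"
proof -
  have "cip (pvec y e) g = cip y (contract e g)"
    by (simp add: cip_def contract_def sum_UNIV_prod sum_distrib_left mult_ac)
  then show ?thesis by (metis Re_cip)
qed

lemma contract_0 [simp]: "contract e 0 = 0"
  by (simp add: contract_def vec_eq_iff)

lemma pvec_0 [simp]: "pvec 0 x = 0" "pvec z 0 = 0"
  by (auto simp: vec_eq_iff)

lemma pvec_add_right: "pvec z (x + y) = pvec z x + pvec z y"
  by (auto simp: vec_eq_iff algebra_simps)

lemma pvec_scaleR: "pvec (c *\<^sub>R z) x = pvec z (c *\<^sub>R x)"
  by (auto simp: vec_eq_iff) (simp_all add: scaleR_conv_of_real)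

lemma pvec_eq_0_iff: "pvec z x = 0 \<longleftrightarrow> z = 0 \<or> x = 0"
  by (simp add: vec_eq_iff split_paired_all)

text \<open>The vectors may be 0, which treats the dimensions 0, 1 and 2 alike.\<close>

lemma two_dim_coordinates:
  fixes V :: "'a::euclidean_space set"
  assumes "subspace V" "dim V \<le> 2"
  obtains e1 e2 where "\<And>y. y \<in> V \<Longrightarrow> y = (y \<bullet> e1) *\<^sub>R e1 + (y \<bullet> e2) *\<^sub>R e2"
proof -
  obtain B where B: "B \<subseteq> V" "pairwise orthogonal B" "\<And>x. x \<in> B \<Longrightarrow> norm x = 1"
    "independent B" "card B = dim V" "span B = V"
    using orthonormal_basis_subspace[OF assms(1)] by blast
  have fin: "finite B" using B(4) independent_imp_finite by blast
  have exp: "y = (\<Sum>b\<in>B. (y \<bullet> b) *\<^sub>R b)" if "y \<in> V" for y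
    using that B fin by (metis orthonormal_basis_expand)
  have "card B \<le> 2" using B(5) assms(2) by simp
  then consider "card B = 0" | "card B = 1" | "card B = 2" by linarith
  then show thesis
  proof cases
    case 1 then show thesis using exp fin by (intro that[of 0 0]) (simp add: card_eq_0_iff)
  next
    case 2
    then obtain b where "B = {b}" by (auto simp: card_1_singleton_iff)
    then show thesis using exp by (intro that[of b 0]) simp
  next
    case 3
    then obtain b c where "B = {b, c}" "b \<noteq> c" by (auto simp: card_2_iff)
    then show thesis using exp by (intro that[of b c]) simp
  qed
qed

lemma nonzero_matrix_vector: "(W::complex^'k^'k) \<noteq> 0 \<Longrightarrow> \<exists>f. W *v f \<noteq> 0"
  by (metis matrix_eq matrix_vector_mult_0)

text \<open>\<open>V\<close> is the whole space when n is at most 2, and a plane in one case with n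
  = 3. With compressions \<open>A\<close> and \<open>B\<close>, \<open>W\<close> maps
  \<open>pvec y e1\<close> to \<open>pvec (A *v y) e1 + pvec (B *v y) e2\<close>, a product vector
  once \<open>B *v y\<close> is a real multiple of \<open>A *v y\<close>.\<close>

lemma product_vector_in_two_dim_range:
  fixes W :: "complex^('m::finite \<times> 'n::finite)^('m \<times> 'n)"
  assumes Wt: "W \<in> tensor Herm Sym" and Wp: "W \<in> Herm_psd" and W0: "W \<noteq> 0"
    and V: "subspace V" "dim V \<le> 2"
    and range: "\<And>f a. (\<chi> i. Re ((W *v f) $ (a, i))) \<in> V"
  shows "\<exists>z x f. pvec z x \<noteq> 0 \<and> W *v f = pvec z x"
proof -
  obtain e1 e2 where e: "\<And>y. y \<in> V \<Longrightarrow> y = (y \<bullet> e1) *\<^sub>R e1 + (y \<bullet> e2) *\<^sub>R e2"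
    using two_dim_coordinates[OF V] by blast
  have WH: "W \<in> Herm" using Wp by (rule Herm_psdD)
  have h: "cnj (W $ p $ q) = W $ q $ p" for p q using WH Herm_iff by blast
  have t: "W $ (a,i) $ (b,j) = W $ (a,j) $ (b,i)" for a b i j using Wt by (metis tensor_iff)
  \<comment> \<open>Multiplying \<open>f\<close> by \<open>- \<i>\<close> turns imaginary parts into
    real parts.\<close>
  have im: "(\<chi> i. Im ((W *v f) $ (a, i))) \<in> V" for f a
  proof -
    have "(\<chi> i. Im ((W *v f) $ (a, i))) = (\<chi> i. Re ((W *v ((- \<i>) *s f)) $ (a, i)))"
      unfolding mult_vector_smult by (simp add: vec_eq_iff)
    then show ?thesis using range by simp
  qed
  have exp: "W *v f = pvec (contract e1 (W *v f)) e1 + pvec (contract e2 (W *v f)) e2" for f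
  proof -
    have "(W *v f) $ (a, i) = (pvec (contract e1 (W *v f)) e1 + pvec (contract e2 (W *v f)) e2) $ (a, i)" for a i
    proof (rule complex_eqI)
      have "(\<chi> i. Re ((W *v f) $ (a, i))) $ i =
          (((\<chi> i. Re ((W *v f) $ (a, i))) \<bullet> e1) *\<^sub>R e1 + ((\<chi> i. Re ((W *v f) $ (a, i))) \<bullet> e2) *\<^sub>R e2) $ i"
        using e[OF range] by metis
      then show "Re ((W *v f) $ (a, i)) = Re ((pvec (contract e1 (W *v f)) e1 + pvec (contract e2 (W *v f)) e2) $ (a, i))"
        by (simp add: contract_def inner_vec_def mult.commute)
      have "(\<chi> i. Im ((W *v f) $ (a, i))) $ i =
          (((\<chi> i. Im ((W *v f) $ (a, i))) \<bullet> e1) *\<^sub>R e1 + ((\<chi> i. Im ((W *v f) $ (a, i))) \<bullet> e2) *\<^sub>R e2) $ i"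
        using e[OF im] by metis
      then show "Im ((W *v f) $ (a, i)) = Im ((pvec (contract e1 (W *v f)) e1 + pvec (contract e2 (W *v f)) e2) $ (a, i))"
        by (simp add: contract_def inner_vec_def mult.commute)
    qed
    then show ?thesis by (auto simp: vec_eq_iff simp del: vector_add_component pvec_nth)
  qed
  define M :: "real^'n \<Rightarrow> real^'n \<Rightarrow> complex^'m^'m" where
    "M u v = (\<chi> a b. \<Sum>i\<in>UNIV. \<Sum>j\<in>UNIV. of_real (u $ i * v $ j) * W $ (a,i) $ (b,j))" for u v
  \<comment> \<open>Hermitian also for distinct \<open>u\<close> and \<open>v\<close>, because the
    symmetry \<open>t\<close> exchanges \<open>i\<close> and \<open>j\<close>.\<close>
  have MH: "M u v \<in> Herm" for u v
    unfolding Herm_iff M_def by (auto simp: h intro!: sum.cong t)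
  have conM: "contract u (W *v pvec y v) = M u v *v y" for u v y
  proof -
    have "contract u (W *v pvec y v) $ a = (M u v *v y) $ a" for a
    proof -
      have "contract u (W *v pvec y v) $ a =
          (\<Sum>i\<in>UNIV. \<Sum>b\<in>UNIV. \<Sum>j\<in>UNIV. of_real (u $ i * v $ j) * W $ (a,i) $ (b,j) * y $ b)"
        by (simp add: contract_def matrix_vector_mult_def sum_UNIV_prod sum_distrib_left mult_ac)
      also have "\<dots> = (\<Sum>b\<in>UNIV. \<Sum>i\<in>UNIV. \<Sum>j\<in>UNIV. of_real (u $ i * v $ j) * W $ (a,i) $ (b,j) * y $ b)"
        by (rule sum.swap)
      also have "\<dots> = (M u v *v y) $ a"
        by (simp add: M_def matrix_vector_mult_def sum_distrib_right)
      finally show ?thesis .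
    qed
    then show ?thesis by (simp add: vec_eq_iff)
  qed
  define A where "A = M e1 e1"
  define B where "B = M e2 e1"
  have expW: "W *v pvec y e1 = pvec (A *v y) e1 + pvec (B *v y) e2" for y
    using exp[of "pvec y e1"] by (simp add: conM A_def B_def)
  have qA: "y \<bullet> (A *v y) = pvec y e1 \<bullet> (W *v pvec y e1)" for y
    by (simp add: inner_pvec conM A_def)
  have kerA: "W *v pvec y e1 = 0" if "y \<bullet> (A *v y) = 0" for y
    using psd_kernel[OF Wp] that qA by metis
  have Apsd: "A \<in> Herm_psd" using MH Wp by (simp add: Herm_psd_iff qA) (simp add: A_def)
  have kerB: "B *v y = 0" if "A *v y = 0" for y
    using kerA[of y] that by (metis conM B_def contract_0 inner_zero_right)
  show ?thesis
  proof (cases "\<forall>y. A *v y = 0")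
    case True
    obtain f where f: "W *v f \<noteq> 0" using nonzero_matrix_vector[OF W0] by blast
    \<comment> \<open>Here all \<open>pvec y e1\<close> lie in the kernel of \<open>W\<close>. The
      range is orthogonal to them, so only its \<open>e2\<close> part remains.\<close>
    have "contract e1 (W *v f) = 0"
    proof -
      have "y \<bullet> contract e1 (W *v f) = 0" for y
        using kerA[of y] True inner_mult_Herm[OF WH, of "pvec y e1" f] by (simp add: inner_pvec[symmetric])
      then show ?thesis by (metis inner_eq_zero_iff)
    qed
    then have "W *v f = pvec (contract e2 (W *v f)) e2" using exp[of f] by simp
    then show ?thesis using f by metis
  next
    case False
    \<comment> \<open>\<open>A\<close> is definite on the orthogonal complement \<open>E\<close> of
      its kernel \<open>N\<close>. As \<open>B\<close> vanishes on \<open>N\<close> too, the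
      equation found on \<open>E\<close> extends to the whole space.\<close>
    define N where "N = {k. A *v k = 0}"
    define E where "E = {x. \<forall>k\<in>N. k \<bullet> x = 0}"
    have subN: "subspace N" unfolding N_def
      by (auto simp: subspace_def matrix_vector_right_distrib linear_scale[OF matrix_vector_mul_linear])
    have subE: "subspace E" unfolding E_def by (auto simp: subspace_def inner_add_right)
    have dec: "\<exists>u\<in>N. \<exists>v\<in>E. y = u + v" for y
    proof -
      obtain u v where "u \<in> span N" "\<And>w. w \<in> span N \<Longrightarrow> orthogonal v w" "y = u + v"
        using orthogonal_subspace_decomp_exists[of N y] by blast
      moreover have "span N = N" using subN by (simp add: span_eq_iff)
      ultimately have "u \<in> N" "v \<in> E" "y = u + v"
        unfolding E_def by (auto simp: orthogonal_def inner_commute)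
      then show ?thesis by blast
    qed
    have "E \<noteq> {0}"
    proof
      assume "E = {0}"
      then have "y \<in> N" for y using dec[of y] by auto
      then show False using False by (auto simp: N_def)
    qed
    moreover have posE: "0 < x \<bullet> (A *v x)" if "x \<in> E" "x \<noteq> 0" for x
    proof (rule ccontr)
      assume "\<not> 0 < x \<bullet> (A *v x)"
      then have "x \<bullet> (A *v x) = 0" using Herm_psdD(2)[OF Apsd, of x] by simp
      then have "x \<in> N" using psd_kernel[OF Apsd] by (simp add: N_def)
      then show False using that by (auto simp: E_def)
    qed
    ultimately obtain x \<nu> where x: "x \<in> E" "x \<noteq> 0" and ev: "\<And>e. e \<in> E \<Longrightarrow> e \<bullet> (B *v x) = \<nu> * (e \<bullet> (A *v x))"
      using generalized_eigenvector[OF matrix_vector_mul_linear inner_mult_Herm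
          matrix_vector_mul_linear inner_mult_Herm subE, of A B] MH
      unfolding A_def B_def by blast
    have "y \<bullet> (B *v x - \<nu> *\<^sub>R (A *v x)) = 0" for y
    proof -
      obtain u v where uv: "u \<in> N" "v \<in> E" "y = u + v" using dec by blast
      have "A *v u = 0" "B *v u = 0" using uv kerB by (auto simp: N_def)
      then have "u \<bullet> (B *v x) = 0" "u \<bullet> (A *v x) = 0"
        using MH by (simp_all add: inner_mult_Herm A_def B_def)
      then show ?thesis using ev[OF uv(2)] uv(3) by (simp add: inner_add_left inner_diff_right)
    qed
    then have "B *v x = \<nu> *\<^sub>R (A *v x)" by (metis inner_eq_zero_iff right_minus_eq)
    then have eq: "W *v pvec x e1 = pvec (A *v x) (e1 + \<nu> *\<^sub>R e2)"
      by (simp add: expW pvec_add_right pvec_scaleR)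
    have "pvec (A *v x) (e1 + \<nu> *\<^sub>R e2) \<noteq> 0"
      using posE[OF x] unfolding qA eq by auto
    then show ?thesis using eq by blast
  qed
qed

text \<open>With a single block the two symmetries make all entries real, so each column of
  \<open>W\<close> is a product vector; the column of a nonzero entry is taken.\<close>

lemma product_vector_in_range_card_one:
  fixes W :: "complex^('m::finite \<times> 'n::finite)^('m \<times> 'n)"
  assumes m: "CARD('m) = 1" and Wt: "W \<in> tensor Herm Sym" and W0: "W \<noteq> 0"
  shows "\<exists>z x f. pvec z x \<noteq> 0 \<and> W *v f = pvec z x"
proof -
  obtain a :: 'm where a: "UNIV = {a}" using m by (metis card_1_singletonE)
  then have all: "b = a" for b by blast
  obtain i j where ij: "W $ (a, i) $ (a, j) \<noteq> 0"
    using W0 all by (auto simp: vec_eq_iff) metis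
  have h: "cnj (W $ (a,i) $ (a,j)) = W $ (a,i) $ (a,j)" for i j
  proof -
    have "cnj (W $ (a,i) $ (a,j)) = W $ (a,j) $ (a,i)" using Wt by (simp add: tensor_iff Herm_iff)
    also have "\<dots> = W $ (a,i) $ (a,j)" using Wt by (metis tensor_iff)
    finally show ?thesis .
  qed
  define x :: "real^'n" where "x = (\<chi> k. Re (W $ (a,k) $ (a,j)))"
  have x: "of_real (x $ k) = W $ (a,k) $ (a,j)" for k
    using h[of k j] by (simp add: x_def complex_eq_iff)
  have eq: "W *v axis (a, j) 1 = pvec (\<chi> a. 1) x"
    by (simp add: vec_eq_iff mult_axis x split_paired_all) (metis all x)
  moreover have "x $ i \<noteq> 0" using ij x[of i] by auto
  then have "pvec (\<chi> a. 1) x \<noteq> (0 :: complex^('m \<times> 'n))"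
    by (auto simp: pvec_eq_0_iff vec_eq_iff)
  ultimately show ?thesis by blast
qed

section \<open>Separability\<close>

lemma kron_outerr_mult: "kron A (outerr x) *v f = pvec (A *v contract x f) x"
proof -
  have "(kron A (outerr x) *v f) $ (a, i) = pvec (A *v contract x f) x $ (a, i)" for a i
    by (simp add: matrix_vector_mult_def contract_def sum_UNIV_prod sum_distrib_left sum_distrib_right mult_ac)
  then show ?thesis by (auto simp: vec_eq_iff simp del: pvec_nth)
qed

lemma kron_Herm: "A \<in> Herm \<Longrightarrow> B \<in> Sym \<Longrightarrow> kron A B \<in> Herm"
  using kron_in_tensor tensor_iff by blast

lemma kron_outerr_psd: "A \<in> Herm_psd \<Longrightarrow> kron A (outerr x) \<in> Herm_psd"
proof -
  assume A: "A \<in> Herm_psd"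
  have "f \<bullet> (kron A (outerr x) *v f) = contract x f \<bullet> (A *v contract x f)" for f
    unfolding kron_outerr_mult inner_commute[of f] inner_pvec by (rule inner_commute)
  then show ?thesis using Herm_psdD[OF A] by (simp add: Herm_psd_iff kron_Herm outerr_Sym)
qed

lemma kron_scaleR_right: "kron A (c *\<^sub>R B) = c *\<^sub>R kron A B"
  by (simp add: vec_eq_iff kron_def) (simp add: scaleR_conv_of_real)

lemma kron_scaleR_left: "kron (c *\<^sub>R A) B = c *\<^sub>R kron A B"
  by (simp add: vec_eq_iff kron_def)

lemma kron_add_right: "kron A (B + C) = kron A B + kron A C"
  by (simp add: vec_eq_iff kron_def algebra_simps)

text \<open>It suffices to write \<open>B\<close> as a sum of nonnegative multiples of matrices
  \<open>outerr x\<close>. This is the cone induction with a one-element first index type: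
  \<open>B\<close> is viewed as the matrix \<open>X\<close> and recovered by
  \<open>re\<close>.\<close>

lemma kron_psd:
  fixes A :: "complex^'m^'m" and B :: "real^'n^'n"
  assumes A: "A \<in> Herm_psd" and B: "B \<in> Sym_psd"
  shows "kron A B \<in> Herm_psd"
proof -
  define re :: "complex^(1 \<times> 'n)^(1 \<times> 'n) \<Rightarrow> real^'n^'n"
    where "re U = (\<chi> i j. Re (U $ (1, i) $ (1, j)))" for U
  have BS: "B \<in> Sym" and Bp: "0 \<le> x \<bullet> (B *v x)" for x using B by (auto simp: Sym_psd_def)
  have H1: "mat 1 \<in> (Herm :: (complex^1^1) set)" by (auto simp: Herm_iff mat_def)
  define X where "X = kron (mat 1 :: complex^1^1) B"
  have Xp: "X \<in> Herm_psd"
  proof -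
    have "0 \<le> f \<bullet> (X *v f)" for f
    proof -
      define fr where "fr = (\<chi> i. Re (f $ (1, i)))"
      define fi where "fi = (\<chi> i. Im (f $ (1, i)))"
      \<comment> \<open>The mixed terms are purely imaginary because \<open>B\<close> is real and
        symmetric.\<close>
      have "f \<bullet> (X *v f) = fr \<bullet> (B *v fr) + fi \<bullet> (B *v fi)"
        by (simp add: X_def fr_def fi_def inner_vec_def matrix_vector_mult_def sum_UNIV_prod UNIV_1
            mat_def inner_complex_def sum.distrib)
      then show ?thesis using Bp by simp
    qed
    then show ?thesis using kron_Herm[OF H1 BS] by (simp add: Herm_psd_iff X_def)
  qed
  have "\<forall>A :: complex^'m^'m. A \<in> Herm_psd \<longrightarrow> kron A (re X) \<in> Herm_psd"
  proof (rule psd_tensor_cone_induct[OF _ Xp])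
    show "X \<in> tensor Herm Sym" unfolding X_def by (rule kron_in_tensor[OF H1 BS])
    fix z :: "complex^1" and x :: "real^'n"
    have "re (outerc (pvec z x)) = (cmod (z $ 1))\<^sup>2 *\<^sub>R outerr x"
      by (simp add: vec_eq_iff re_def cmod_def power2_eq_square algebra_simps)
    then show "\<forall>A :: complex^'m^'m. A \<in> Herm_psd \<longrightarrow> kron A (re (outerc (pvec z x))) \<in> Herm_psd"
      by (simp add: kron_scaleR_right psd_scale kron_outerr_psd)
  next
    fix U V
    assume "\<forall>A :: complex^'m^'m. A \<in> Herm_psd \<longrightarrow> kron A (re U) \<in> Herm_psd"
      "\<forall>A :: complex^'m^'m. A \<in> Herm_psd \<longrightarrow> kron A (re V) \<in> Herm_psd"
    moreover have "re (U + V) = re U + re V" by (simp add: re_def vec_eq_iff)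
    ultimately show "\<forall>A :: complex^'m^'m. A \<in> Herm_psd \<longrightarrow> kron A (re (U + V)) \<in> Herm_psd"
      by (simp add: kron_add_right psd_add)
  next
    fix c :: real and U
    assume "0 \<le> c" "\<forall>A :: complex^'m^'m. A \<in> Herm_psd \<longrightarrow> kron A (re U) \<in> Herm_psd"
    moreover have "re (c *\<^sub>R U) = c *\<^sub>R re U" by (simp add: re_def vec_eq_iff)
    ultimately show "\<forall>A :: complex^'m^'m. A \<in> Herm_psd \<longrightarrow> kron A (re (c *\<^sub>R U)) \<in> Herm_psd"
      by (simp add: kron_scaleR_right psd_scale)
  next
    fix W :: "complex^(1 \<times> 'n)^(1 \<times> 'n)"
    assume "W \<in> tensor Herm Sym" "W \<noteq> 0"
    then show "\<exists>z x f. pvec z x \<noteq> 0 \<and> W *v f = pvec z x"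
      by (intro product_vector_in_range_card_one) simp_all
  qed
  moreover have "re X = B" by (simp add: re_def X_def vec_eq_iff mat_def)
  ultimately show ?thesis using A by simp
qed

lemma separable_psd: "separable Herm_psd Sym_psd X \<Longrightarrow> X \<in> Herm_psd"
proof -
  assume "separable Herm_psd Sym_psd X"
  then obtain k F G where FG: "\<forall>l<(k::nat). F l \<in> Herm_psd \<and> G l \<in> Sym_psd"
    and X: "X = (\<Sum>l<k. kron (F l) (G l))"
    unfolding separable_def by blast
  show ?thesis unfolding X by (rule psd_sum) (simp add: FG kron_psd)
qed

lemma separable_kron: "A \<in> P \<Longrightarrow> B \<in> Q \<Longrightarrow> separable P Q (kron A B)"
  unfolding separable_def by (intro exI[of _ 1] exI[of _ "\<lambda>_. A"] exI[of _ "\<lambda>_. B"]) auto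

lemma separable_add_kron:
  assumes "separable P Q X" "A \<in> P" "B \<in> Q"
  shows "separable P Q (X + kron A B)"
proof -
  obtain k F G where FG: "\<forall>l<(k::nat). F l \<in> P \<and> G l \<in> Q" "X = (\<Sum>l<k. kron (F l) (G l))"
    using assms(1) unfolding separable_def by blast
  have "(\<Sum>l<k. kron ((F(k := A)) l) ((G(k := B)) l)) = X"
    unfolding FG(2) by (intro sum.cong) auto
  then show ?thesis unfolding separable_def using FG(1) assms
    by (intro exI[of _ "Suc k"] exI[of _ "F(k := A)"] exI[of _ "G(k := B)"]) (auto simp: less_Suc_eq)
qed

lemma separable_add:
  assumes X: "separable P Q X" and "separable P Q Y"
  shows "separable P Q (X + Y)"
proof -
  obtain k F G where FG: "\<forall>l<(k::nat). F l \<in> P \<and> G l \<in> Q" "Y = (\<Sum>l<k. kron (F l) (G l))"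
    using assms(2) unfolding separable_def by blast
  have "separable P Q (X + (\<Sum>l<j. kron (F l) (G l)))" if "j \<le> k" for j
    using that
  proof (induction j)
    case (Suc j)
    then show ?case using separable_add_kron[of P Q _ "F j" "G j"] FG(1)
      by (simp add: add.assoc[symmetric])
  qed (simp add: X)
  then show ?thesis using FG(2) by blast
qed

lemma separable_scaleR:
  assumes "separable Herm_psd Q X" "0 \<le> c"
  shows "separable Herm_psd Q (c *\<^sub>R X)"
proof -
  obtain k F G where FG: "\<forall>l<(k::nat). F l \<in> Herm_psd \<and> G l \<in> Q" "X = (\<Sum>l<k. kron (F l) (G l))"
    using assms(1) unfolding separable_def by blast
  have "c *\<^sub>R X = (\<Sum>l<k. kron (c *\<^sub>R F l) (G l))"
    by (simp add: FG(2) kron_scaleR_left scaleR_sum_right)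
  then show ?thesis unfolding separable_def using FG(1) assms(2)
    by (intro exI[of _ k] exI[of _ "\<lambda>l. c *\<^sub>R F l"] exI[of _ G]) (simp add: psd_scale)
qed

lemma psd_tensor_separable:
  fixes X :: "complex^('m::finite \<times> 'n::finite)^('m \<times> 'n)"
  assumes X: "X \<in> tensor Herm Sym" "X \<in> Herm_psd"
    and range: "\<And>W :: complex^('m \<times> 'n)^('m \<times> 'n).
      W \<in> tensor Herm Sym \<Longrightarrow> W \<in> Herm_psd \<Longrightarrow> W \<noteq> 0 \<Longrightarrow>
      (\<And>H. H \<in> tensor Herm Sym \<Longrightarrow> W + H \<in> Herm_psd \<Longrightarrow> W - H \<in> Herm_psd \<Longrightarrow> \<exists>c. H = c *\<^sub>R W) \<Longrightarrow>
      \<exists>z x f. pvec z x \<noteq> 0 \<and> W *v f = pvec z x"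
  shows "separable Herm_psd Sym_psd X"
  using X
proof (rule psd_tensor_cone_induct)
  show "separable Herm_psd Sym_psd (outerc (pvec z x))" for z x
    unfolding kron_outer[symmetric] by (intro separable_kron outerc_psd outerr_psd)
qed (use range separable_add separable_scaleR in auto)

section \<open>Extreme rays of rank at least four\<close>

lemma linear_not_inj:
  fixes T :: "'a::euclidean_space \<Rightarrow> 'b::euclidean_space"
  assumes "linear T" "DIM('b) < DIM('a)"
  shows "\<exists>x. x \<noteq> 0 \<and> T x = 0"
proof (rule ccontr)
  assume "\<not> ?thesis"
  then have "inj T" using linear_injective_0[OF assms(1)] by blast
  then have "dim (T ` UNIV) = DIM('a)" using dim_image_eq[OF assms(1), of UNIV] by simp
  then show False using dim_subset_UNIV[of "T ` UNIV"] assms(2) by simp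
qed

lemma cip_outer_combination:
  fixes v :: "'d::finite \<Rightarrow> complex^'k"
  assumes G: "\<And>p q. G $ p $ q = (\<Sum>a\<in>UNIV. \<Sum>b\<in>UNIV. h a b * v a $ p * cnj (v b $ q))"
  shows "f \<bullet> (G *v f) = Re (\<Sum>a\<in>UNIV. \<Sum>b\<in>UNIV. h a b * cnj (cip (v a) f) * cip (v b) f)"
proof -
  have "cip f (G *v f) = (\<Sum>p\<in>UNIV. \<Sum>q\<in>UNIV. \<Sum>a\<in>UNIV. \<Sum>b\<in>UNIV.
      cnj (f $ p) * (h a b * v a $ p * cnj (v b $ q)) * f $ q)"
    by (simp add: cip_def matrix_vector_mult_def G sum_distrib_left sum_distrib_right mult_ac)
  also have "\<dots> = (\<Sum>p\<in>UNIV. \<Sum>a\<in>UNIV. \<Sum>b\<in>UNIV. \<Sum>q\<in>UNIV.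
      cnj (f $ p) * (h a b * v a $ p * cnj (v b $ q)) * f $ q)"
    by (intro sum.cong refl) (subst sum.swap, intro sum.cong refl, rule sum.swap)
  also have "\<dots> = (\<Sum>a\<in>UNIV. \<Sum>b\<in>UNIV. \<Sum>p\<in>UNIV. \<Sum>q\<in>UNIV.
      cnj (f $ p) * (h a b * v a $ p * cnj (v b $ q)) * f $ q)"
    by (subst sum.swap, intro sum.cong refl, rule sum.swap)
  also have "\<dots> = (\<Sum>a\<in>UNIV. \<Sum>b\<in>UNIV. h a b * cnj (cip (v a) f) * cip (v b) f)"
  proof (intro sum.cong refl)
    fix a b
    have "cnj (cip (v a) f) * cip (v b) f =
        (\<Sum>p\<in>UNIV. \<Sum>q\<in>UNIV. (v a $ p * cnj (f $ p)) * (cnj (v b $ q) * f $ q))"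
      by (simp add: cip_def sum_product)
    then show "(\<Sum>p\<in>UNIV. \<Sum>q\<in>UNIV. cnj (f $ p) * (h a b * v a $ p * cnj (v b $ q)) * f $ q) =
        h a b * cnj (cip (v a) f) * cip (v b) f"
      by (simp add: sum_distrib_left mult.assoc) (simp add: mult_ac)
  qed
  finally show ?thesis by (metis Re_cip)
qed

text \<open>Cauchy-Schwarz bounds each \<open>cip (W *v g a) f\<close> by the form of
  \<open>W\<close> at \<open>f\<close>, and products of two are split as sums of squares. Thus a
  small multiple of a hermitian \<open>G\<close> of this kind can be added to and subtracted from
  \<open>W\<close> within the PSD cone.\<close>

lemma range_combination_bound:
  fixes g :: "'d::finite \<Rightarrow> complex^'k"
  assumes W: "W \<in> Herm_psd"
    and G: "\<And>p q. G $ p $ q = (\<Sum>a\<in>UNIV. \<Sum>b\<in>UNIV. h a b * (W *v g a) $ p * cnj ((W *v g b) $ q))"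
  shows "\<exists>C>0. \<forall>f. \<bar>f \<bullet> (G *v f)\<bar> \<le> C * (f \<bullet> (W *v f))"
proof -
  define K where "K a = g a \<bullet> (W *v g a)" for a
  define C where "C = (\<Sum>a\<in>UNIV. \<Sum>b\<in>UNIV. cmod (h a b) * (K a + K b))"
  have K: "0 \<le> K a" for a unfolding K_def by (rule Herm_psdD(2)[OF W])
  have C: "0 \<le> C" unfolding C_def by (intro sum_nonneg mult_nonneg_nonneg add_nonneg_nonneg K) simp
  \<comment> \<open>\<open>C\<close> may be 0, for instance when \<open>h\<close> vanishes; adding 1
    makes the constant positive.\<close>
  have "\<bar>f \<bullet> (G *v f)\<bar> \<le> (C + 1) * (f \<bullet> (W *v f))" for f
  proof -
    define q where "q = f \<bullet> (W *v f)"
    define s where "s a = cmod (cip (W *v g a) f)" for a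
    have q: "0 \<le> q" unfolding q_def by (rule Herm_psdD(2)[OF W])
    have s: "(s a)\<^sup>2 \<le> 2 * K a * q" for a
      unfolding s_def K_def q_def by (rule psd_cip_cauchy_schwarz[OF W])
    have ss: "s a * s b \<le> (K a + K b) * q" for a b
    proof -
      have "2 * (s a * s b) \<le> (s a)\<^sup>2 + (s b)\<^sup>2" using sum_squares_bound[of "s a" "s b"] by simp
      then show ?thesis using s[of a] s[of b] by (simp add: algebra_simps)
    qed
    have "\<bar>f \<bullet> (G *v f)\<bar> \<le> cmod (\<Sum>a\<in>UNIV. \<Sum>b\<in>UNIV. h a b * cnj (cip (W *v g a) f) * cip (W *v g b) f)"
      unfolding cip_outer_combination[OF G] by (rule abs_Re_le_cmod)
    also have "\<dots> \<le> (\<Sum>a\<in>UNIV. \<Sum>b\<in>UNIV. cmod (h a b) * (s a * s b))"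
      by (intro sum_norm_le) (simp add: norm_mult s_def)
    also have "\<dots> \<le> (\<Sum>a\<in>UNIV. \<Sum>b\<in>UNIV. cmod (h a b) * ((K a + K b) * q))"
      by (intro sum_mono mult_left_mono ss) simp
    also have "\<dots> = C * q" by (simp add: C_def sum_distrib_right mult.assoc)
    also have "\<dots> \<le> (C + 1) * q" using q by (simp add: algebra_simps)
    finally show ?thesis by (simp add: q_def)
  qed
  then show ?thesis using C by (intro exI[of _ "C + 1"]) auto
qed

text \<open>A linear parametrisation of the hermitian forms by real square matrices.\<close>

definition herm_of_real :: "real^'d^'d \<Rightarrow> 'd \<Rightarrow> 'd \<Rightarrow> complex" where
  "herm_of_real M a b = Complex (M $ a $ b + M $ b $ a) (M $ a $ b - M $ b $ a)"

text \<open>The product V H V^* with columns \<open>v a\<close> in V and H the hermitian matrix of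
  \<open>M\<close>. The domain \<open>real^'d^'d\<close> has as real dimension the square of the
  number of vectors, as needed for the dimension count.\<close>

definition congr :: "('d \<Rightarrow> complex^'k) \<Rightarrow> real^'d^'d \<Rightarrow> complex^'k^'k" where
  "congr v M = (\<chi> p q. \<Sum>a\<in>UNIV. \<Sum>b\<in>UNIV. herm_of_real M a b * v a $ p * cnj (v b $ q))"

lemma linear_congr: "linear (congr v)"
proof -
  have "herm_of_real (M + N) a b = herm_of_real M a b + herm_of_real N a b" for M N :: "real^'a^'a" and a b
    by (simp add: herm_of_real_def complex_eq_iff)
  moreover have "herm_of_real (c *\<^sub>R M) a b = c *\<^sub>R herm_of_real M a b" for c and M :: "real^'a^'a" and a b
    by (simp add: herm_of_real_def complex_eq_iff algebra_simps)
  ultimately show ?thesis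
    by (simp add: linear_iff congr_def vec_eq_iff sum.distrib distrib_right scaleR_sum_right)
qed

lemma congr_Herm: "congr v M \<in> Herm"
proof -
  have h: "cnj (herm_of_real M a b) = herm_of_real M b a" for a b
    by (simp add: herm_of_real_def complex_eq_iff)
  have "cnj (congr v M $ q $ p) = (\<Sum>a\<in>UNIV. \<Sum>b\<in>UNIV. herm_of_real M b a * v b $ p * cnj (v a $ q))" for p q
    by (simp add: congr_def h mult_ac)
  moreover have "(\<Sum>a\<in>UNIV. \<Sum>b\<in>UNIV. herm_of_real M b a * v b $ p * cnj (v a $ q)) = congr v M $ p $ q" for p q
    unfolding congr_def vec_lambda_beta by (rule sum.swap)
  ultimately show ?thesis by (simp add: Herm_iff)
qed

text \<open>Independence is used twice: for the left factors at each fixed \<open>q\<close>, then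
  after conjugation for the right factors.\<close>

lemma congr_eq_0:
  fixes v :: "'d::finite \<Rightarrow> complex^'k"
  assumes indep: "\<And>c. (\<Sum>a\<in>UNIV. c a *s v a) = 0 \<Longrightarrow> c = (\<lambda>_. 0)"
    and 0: "congr v M = 0"
  shows "M = 0"
proof -
  have "(\<Sum>a\<in>UNIV. (\<Sum>b\<in>UNIV. herm_of_real M a b * cnj (v b $ q)) *s v a) = 0" for q
  proof -
    have "(\<Sum>a\<in>UNIV. (\<Sum>b\<in>UNIV. herm_of_real M a b * cnj (v b $ q)) *s v a) $ p = congr v M $ p $ q" for p
      by (simp add: congr_def sum_distrib_left sum_distrib_right mult_ac)
    then show ?thesis using 0 by (simp add: vec_eq_iff)
  qed
  from indep[OF this] have "(\<Sum>b\<in>UNIV. herm_of_real M a b * cnj (v b $ q)) = 0" for a q by metis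
  then have "cnj (\<Sum>b\<in>UNIV. herm_of_real M a b * cnj (v b $ q)) = 0" for a q by simp
  then have "(\<Sum>b\<in>UNIV. cnj (herm_of_real M a b) *s v b) = 0" for a
    by (simp add: vec_eq_iff)
  from indep[OF this] have "cnj (herm_of_real M a b) = 0" for a b by metis
  then have hz: "herm_of_real M a b = 0" for a b by simp
  have mm: "M $ a $ b + M $ b $ a = 0" "M $ a $ b - M $ b $ a = 0" for a b
    using hz[of a b] by (simp_all add: herm_of_real_def complex_eq_iff)
  have "M $ a $ b = 0" for a b
    using mm[of a b] by linarith
  then show ?thesis by (simp add: vec_eq_iff)
qed

text \<open>As \<open>'n option\<close> has 4 elements, the matrices \<open>M\<close> form a
  16-dimensional space, while \<open>T\<close> has values in dimension 13. A nonzero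
  \<open>M\<close> with \<open>T M = 0\<close> gives \<open>H\<close> up to scaling; its trace zero
  later excludes multiples of \<open>W\<close>.\<close>

lemma not_extreme_if_rank_four:
  fixes W :: "complex^('m::finite \<times> 'n::finite)^('m \<times> 'n)" and g :: "'n option \<Rightarrow> complex^('m \<times> 'n)"
  assumes m: "CARD('m) = 2" and n: "CARD('n) = 3"
    and Wt: "W \<in> tensor Herm Sym" and Wp: "W \<in> Herm_psd"
    and indep: "\<And>c. (\<Sum>a\<in>UNIV. c a *s (W *v g a)) = 0 \<Longrightarrow> c = (\<lambda>_. 0)"
  shows "\<exists>H. H \<in> tensor Herm Sym \<and> H \<noteq> 0 \<and> rtrace H = 0 \<and> W + H \<in> Herm_psd \<and> W - H \<in> Herm_psd"
proof -
  obtain a1 a2 :: 'm where a: "UNIV = {a1, a2}" "a1 \<noteq> a2" using m by (metis card_2_iff)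
  obtain i1 i2 i3 :: 'n where i: "UNIV = {i1, i2, i3}" using n by (metis card_3_iff)
  define Phi where "Phi = congr (\<lambda>a. W *v g a)"
  have lin: "linear Phi" unfolding Phi_def by (rule linear_congr)
  \<comment> \<open>The defect of the transposition symmetry of \<open>Phi M\<close>.\<close>
  define D where "D M i j a b = Phi M $ (a, i) $ (b, j) - Phi M $ (a, j) $ (b, i)" for M i j a b
  have D_add: "D (M + N) i j a b = D M i j a b + D N i j a b"
    and D_scale: "D (c *\<^sub>R M) i j a b = c *\<^sub>R D M i j a b" for M N i j a b c
    by (simp_all add: D_def linear_add[OF lin] linear_scale[OF lin] algebra_simps)
  \<comment> \<open>For fixed \<open>i\<close> and \<open>j\<close> the 2 by 2 matrix
    \<open>D M i j\<close> is anti-hermitian, hence given by two imaginary diagonal entries and one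
    complex entry. That is 4 real numbers for each of the 3 index pairs; the trace is the 13th
    condition.\<close>
  define d where "d M i j = (Complex (Im (D M i j a1 a1)) (Im (D M i j a2 a2)), D M i j a1 a2)" for M i j
  have d_add: "d (M + N) i j = d M i j + d N i j" and d_scale: "d (c *\<^sub>R M) i j = c *\<^sub>R d M i j" for M N i j c
    by (simp_all add: d_def D_add D_scale complex_eq_iff)
  define T where "T M = (d M i1 i2, d M i1 i3, d M i2 i3, rtrace (Phi M))" for M
  have "linear T" unfolding T_def
    by (simp add: linear_iff d_add d_scale linear_add[OF lin] linear_scale[OF lin]
        linear_add[OF linear_rtrace] linear_scale[OF linear_rtrace])
  then have "\<exists>M. M \<noteq> 0 \<and> T M = 0"
    by (rule linear_not_inj) (simp add: n card_UNIV_option)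
  then obtain M where M: "M \<noteq> 0" "T M = 0" by blast
  have PH: "Phi M \<in> Herm" unfolding Phi_def by (rule congr_Herm)
  have PH': "cnj (Phi M $ p $ q) = Phi M $ q $ p" for p q using PH Herm_iff by blast
  have P0: "Phi M \<noteq> 0" using congr_eq_0[of "\<lambda>a. W *v g a" M, OF indep] M(1) unfolding Phi_def by blast
  have D0: "D M i j a b = 0" for i j a b
  proof -
    have anti: "D M i j b a = - cnj (D M i j a b)" for i j a b by (simp add: D_def PH')
    have swap: "D M j i a b = - D M i j a b" for i j a b by (simp add: D_def)
    have re: "Re (D M i j a a) = 0" for i j a using anti[of i j a a] by (simp add: complex_eq_iff)
    have diag: "D M i i a b = 0" for i a b by (simp add: D_def)
    have dz: "D M i j a b = 0" if "d M i j = 0" for i j a b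
    proof -
      have z: "D M i j a1 a1 = 0" "D M i j a2 a2 = 0" "D M i j a1 a2 = 0"
        using that re[of i j a1] re[of i j a2] by (simp_all add: d_def complex_eq_iff zero_prod_def)
      moreover have "D M i j a2 a1 = 0" using anti[of i j a2 a1] z by simp
      moreover have "a \<in> {a1, a2}" "b \<in> {a1, a2}" using a by auto
      ultimately show ?thesis by auto
    qed
    have "d M i1 i2 = 0" "d M i1 i3 = 0" "d M i2 i3 = 0" using M(2) by (simp_all add: T_def zero_prod_def)
    then have "D M i1 i2 a b = 0" "D M i1 i3 a b = 0" "D M i2 i3 a b = 0" for a b using dz by auto
    moreover have "i \<in> {i1, i2, i3}" "j \<in> {i1, i2, i3}" using i by auto
    ultimately show ?thesis using swap diag
      by (metis empty_iff insert_iff neg_equal_0_iff_equal)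
  qed
  have Pt: "Phi M \<in> tensor Herm Sym" unfolding tensor_iff using PH D0 unfolding D_def by simp
  have tr: "rtrace (Phi M) = 0" using M(2) by (simp add: T_def zero_prod_def)
  obtain C where C: "C > 0" "\<And>f. \<bar>f \<bullet> (Phi M *v f)\<bar> \<le> C * (f \<bullet> (W *v f))"
    using range_combination_bound[OF Wp, of "Phi M" "herm_of_real M" g]
    unfolding Phi_def congr_def by auto
  define H where "H = (1/C) *\<^sub>R Phi M"
  have Ht: "H \<in> tensor Herm Sym" unfolding H_def by (rule subspace_scale[OF subspace_tensor Pt])
  have HH: "H \<in> Herm" using Ht by (simp add: tensor_iff)
  have bnd: "\<bar>f \<bullet> (H *v f)\<bar> \<le> f \<bullet> (W *v f)" for f
    using C(1) C(2)[of f] by (simp add: H_def scaleR_matrix_vector abs_mult field_simps)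
  have "W + H \<in> Herm_psd" "W - H \<in> Herm_psd"
    unfolding Herm_psd_iff
    using bnd Herm_psdD(1)[OF Wp] HH
    by (auto intro!: subspace_add[OF subspace_Herm] subspace_diff[OF subspace_Herm] simp: abs_le_iff
        matrix_vector_mult_add_rdistrib matrix_vector_mult_diff_rdistrib inner_add_right inner_diff_right)
       (smt (verit))+
  moreover have "rtrace H = 0" by (simp add: H_def linear_scale[OF linear_rtrace] tr)
  moreover have "H \<noteq> 0" using P0 C(1) by (simp add: H_def)
  ultimately show ?thesis using Ht by blast
qed

section \<open>Product vectors in the case m = 2, n = 3\<close>

lemma product_vector_in_range_two_three:
  fixes W :: "complex^('m::finite \<times> 'n::finite)^('m \<times> 'n)"
  assumes m: "CARD('m) = 2" and n: "CARD('n) = 3"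
    and Wt: "W \<in> tensor Herm Sym" and Wp: "W \<in> Herm_psd" and W0: "W \<noteq> 0"
    and ext: "\<And>H. H \<in> tensor Herm Sym \<Longrightarrow> W + H \<in> Herm_psd \<Longrightarrow> W - H \<in> Herm_psd \<Longrightarrow> \<exists>c. H = c *\<^sub>R W"
  shows "\<exists>z x f. pvec z x \<noteq> 0 \<and> W *v f = pvec z x"
proof -
  obtain a1 a2 :: 'm where a: "UNIV = {a1, a2}" "a1 \<noteq> a2" using m by (metis card_2_iff)
  have acases: "b = a1 \<or> b = a2" for b :: 'm using a(1) by blast
  have sum_m: "(\<Sum>b\<in>UNIV. \<phi> b) = \<phi> a1 + \<phi> a2" for \<phi> :: "'m \<Rightarrow> complex" unfolding a(1) using a(2) by simp
  have sum_mr: "(\<Sum>b\<in>UNIV. \<phi> b) = \<phi> a1 + \<phi> a2" for \<phi> :: "'m \<Rightarrow> real" unfolding a(1) using a(2) by simp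
  have WH: "W \<in> Herm" using Wp by (rule Herm_psdD)
  have h: "cnj (W $ p $ q) = W $ q $ p" for p q using WH Herm_iff by blast
  have t: "W $ (a,i) $ (b,j) = W $ (a,j) $ (b,i)" for a b i j using Wt by (metis tensor_iff)
  define A where "A = (\<chi> i j. Re (W $ (a1,i) $ (a1,j)))"
  define B where "B = (\<chi> i j. Re (W $ (a2,i) $ (a2,j)))"
  define X where "X = (\<chi> i j. Re (W $ (a1,i) $ (a2,j)))"
  define Y where "Y = (\<chi> i j. Im (W $ (a1,i) $ (a2,j)))"
  have real: "Im (W $ (b,i) $ (b,j)) = 0" for b i j
    using h[of "(b,i)" "(b,j)"] t[of b j b i] by (simp add: complex_eq_iff)
  have W11: "W $ (a1,i) $ (a1,j) = of_real (A $ i $ j)" for i j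
    by (simp add: A_def complex_eq_iff real)
  have W22: "W $ (a2,i) $ (a2,j) = of_real (B $ i $ j)" for i j
    by (simp add: B_def complex_eq_iff real)
  have W12: "W $ (a1,i) $ (a2,j) = Complex (X $ i $ j) (Y $ i $ j)" for i j
    by (simp add: X_def Y_def complex_eq_iff)
  have W21: "W $ (a2,i) $ (a1,j) = Complex (X $ i $ j) (- Y $ i $ j)" for i j
    using h[of "(a1,j)" "(a2,i)"] t[of a1 j a2 i] by (simp add: W12 complex_eq_iff)
  have symA: "A $ i $ j = A $ j $ i" for i j by (simp add: A_def t[of a1 i a1 j])
  have symX: "X $ i $ j = X $ j $ i" for i j by (simp add: X_def t[of a1 i a2 j])
  have symY: "Y $ i $ j = Y $ j $ i" for i j by (simp add: Y_def t[of a1 i a2 j])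
  have selfadj: "u \<bullet> (Q *v v) = (Q *v u) \<bullet> v" if "\<And>i j. Q $ i $ j = Q $ j $ i" for Q :: "real^'n^'n" and u v
  proof -
    have "transpose Q = Q" using that by (simp add: transpose_def vec_eq_iff)
    then show ?thesis by (metis dot_lmul_matrix transpose_matrix_vector)
  qed
  note adjA = selfadj[OF symA] and adjX = selfadj[OF symX] and adjY = selfadj[OF symY]
  \<comment> \<open>Separates the real and imaginary parts of the two blocks of a vector, so that
    \<open>W\<close> acts through the real matrices \<open>A\<close>, \<open>B\<close>,
    \<open>X\<close> and \<open>Y\<close>.\<close>
  define F :: "real^'n \<Rightarrow> real^'n \<Rightarrow> real^'n \<Rightarrow> real^'n \<Rightarrow> complex^('m \<times> 'n)" where
    "F p r u v = (\<chi> k. if fst k = a1 then Complex (p $ snd k) (r $ snd k) else Complex (u $ snd k) (v $ snd k))" for p r u v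
  have F1: "F p r u v $ (a1, i) = Complex (p $ i) (r $ i)" and F2: "F p r u v $ (a2, i) = Complex (u $ i) (v $ i)" for p r u v i
    using a(2) by (simp_all add: F_def)
  have eqI: "f = g" if "\<And>i. f $ (a1, i) = g $ (a1, i)" "\<And>i. f $ (a2, i) = g $ (a2, i)" for f g :: "complex^('m \<times> 'n)"
  proof -
    have "f $ (b, i) = g $ (b, i)" for b i using that[of i] acases[of b] by auto
    then show ?thesis by (simp add: vec_eq_iff split_paired_all)
  qed
  have F_eq_0: "F p r u v = 0 \<longleftrightarrow> p = 0 \<and> r = 0 \<and> u = 0 \<and> v = 0" for p r u v
  proof
    assume "F p r u v = 0"
    then have "F p r u v $ (a1, i) = 0" "F p r u v $ (a2, i) = 0" for i by simp_all
    then show "p = 0 \<and> r = 0 \<and> u = 0 \<and> v = 0" by (simp add: F1 F2 vec_eq_iff complex_eq_iff)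
  next
    assume "p = 0 \<and> r = 0 \<and> u = 0 \<and> v = 0"
    then show "F p r u v = 0" by (intro eqI) (simp_all add: F1 F2 complex_eq_iff)
  qed
  have WF: "W *v F p r u v = F (A *v p + X *v u - Y *v v) (A *v r + X *v v + Y *v u)
      (X *v p + Y *v r + B *v u) (X *v r - Y *v p + B *v v)" for p r u v
    by (rule eqI; rule complex_eqI)
       (simp_all add: F1 F2 matrix_vector_mult_def sum_UNIV_prod sum_m W11 W12 W21 W22
          sum.distrib sum_subtractf sum_negf)
  have inner_F: "F p r u v \<bullet> F p' r' u' v' = p \<bullet> p' + r \<bullet> r' + u \<bullet> u' + v \<bullet> v'" for p r u v p' r' u' v'
    by (simp add: inner_vec_def sum_UNIV_prod sum_mr F1 F2 inner_complex_def sum.distrib)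
  have qA: "F x 0 0 0 \<bullet> (W *v F x 0 0 0) = x \<bullet> (A *v x)" for x
    by (simp add: WF inner_F)
  show ?thesis
  proof (cases "\<exists>x. x \<noteq> 0 \<and> A *v x = 0")
    case True
    \<comment> \<open>A kernel vector \<open>x\<close> of \<open>A\<close> is also killed by
      \<open>X\<close> and \<open>Y\<close>, so \<open>F 0 0 x 0\<close> is mapped to a product
      vector. If that is 0, all slices of the range lie in the plane orthogonal to \<open>x\<close>,
      and the two-dimensional result applies.\<close>
    then obtain x where x: "x \<noteq> 0" "A *v x = 0" by blast
    have ker: "W *v F x 0 0 0 = 0" using psd_kernel[OF Wp] qA x(2) by simp
    then have XY: "X *v x = 0" "Y *v x = 0" unfolding WF F_eq_0 by auto
    have eq: "W *v F 0 0 x 0 = pvec (axis a2 1) (B *v x)"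
      unfolding WF using a(2) XY by (intro eqI) (auto simp: F1 F2 axis_def complex_eq_iff)
    show ?thesis
    proof (cases "B *v x = 0")
      case False
      then show ?thesis using eq by (intro exI[of _ "axis a2 1"] exI[of _ "B *v x"]) (auto simp: pvec_eq_0_iff)
    next
      case True
      have ker2: "W *v F 0 0 x 0 = 0" using eq True by simp
      have e1: "pvec (axis a1 1) x = F x 0 0 0" and e2: "pvec (axis a2 1) x = F 0 0 x 0"
        using a(2) by (auto intro!: eqI simp: F1 F2 axis_def complex_eq_iff)
      have kerb: "W *v pvec (axis b 1) x = 0" for b
        using acases[of b] ker ker2 e1 e2 by auto
      show ?thesis
      proof (rule product_vector_in_two_dim_range[OF Wt Wp W0])
        show "subspace {y. x \<bullet> y = 0}" by (rule subspace_hyperplane)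
        show "dim {y. x \<bullet> y = 0} \<le> 2" using dim_hyperplane[OF x(1)] n by simp
        fix f b
        have "pvec (axis b 1) x \<bullet> (W *v f) = 0" using kerb inner_mult_Herm[OF WH] by simp
        then show "(\<chi> i. Re ((W *v f) $ (b, i))) \<in> {y. x \<bullet> y = 0}"
          unfolding inner_pvec inner_axis' by (simp add: contract_def inner_vec_def inner_complex_def)
      qed
    qed
  next
    case False
    then have injA: "A *v x = 0 \<Longrightarrow> x = 0" for x by blast
    have posA: "0 < x \<bullet> (A *v x)" if "x \<noteq> 0" for x
    proof (rule ccontr)
      assume "\<not> 0 < x \<bullet> (A *v x)"
      then have "F x 0 0 0 \<bullet> (W *v F x 0 0 0) = 0" using Herm_psdD(2)[OF Wp, of "F x 0 0 0"] qA[of x] by simp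
      then have "W *v F x 0 0 0 = 0" by (rule psd_kernel[OF Wp])
      then show False using injA[of x] that unfolding WF F_eq_0 by simp
    qed
    have "inj ((*v) A)" using injA by (intro linear_injective_0[THEN iffD2]) auto
    then have "surj ((*v) A)" by (intro linear_injective_imp_surjective) auto
    then have surjA: "\<exists>x. A *v x = y" for y by (metis surj_def)
    \<comment> \<open>Block elimination: the image is the Schur complement of \<open>A\<close>
      applied to the real vector \<open>z\<close>, placed in the second block.\<close>
    have elim: "W *v F p r z 0 = F 0 0 (X *v p + Y *v r + B *v z) (X *v r - Y *v p)"
      if "A *v p = - (X *v z)" "A *v r = - (Y *v z)" for z p r
      by (simp add: WF that)
    \<comment> \<open>Such a vector would be independent of the images of the three basis vectors of
      the first block, whose upper parts are the columns of the invertible \<open>A\<close>. The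
      rank would be at least 4, contradicting extremality.\<close>
    have F_indep: "\<not> (F 0 0 u v \<noteq> 0 \<and> (\<exists>g. W *v g = F 0 0 u v))" for u v
    proof
      assume "F 0 0 u v \<noteq> 0 \<and> (\<exists>g. W *v g = F 0 0 u v)"
      then obtain g where g: "W *v g = F 0 0 u v" "F 0 0 u v \<noteq> 0" by blast
      define G where "G = (\<lambda>k. case k of None \<Rightarrow> g | Some i \<Rightarrow> axis (a1, i) (1::complex))"
      have indep: "c = (\<lambda>_. 0)" if 0: "(\<Sum>k\<in>UNIV. c k *s (W *v G k)) = 0" for c
      proof -
        define p where "p = (\<chi> i. Re (c (Some i)))"
        define r where "r = (\<chi> i. Im (c (Some i)))"
        have s: "(\<Sum>k\<in>UNIV. c k *s (W *v G k)) = c None *s F 0 0 u v + W *v F p r 0 0"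
        proof -
          have "(\<Sum>k\<in>UNIV. c k *s (W *v G k)) = c None *s F 0 0 u v + (\<Sum>i\<in>UNIV. c (Some i) *s (W *v axis (a1, i) 1))"
            by (simp add: UNIV_option_conv sum.reindex G_def g(1))
          also have "(\<Sum>i\<in>UNIV. c (Some i) *s (W *v axis (a1, i) 1)) = W *v F p r 0 0"
          proof -
            have "(\<Sum>i\<in>UNIV. c (Some i) *s (W *v axis (a1, i) 1)) $ q = (W *v F p r 0 0) $ q" for q
            proof -
              have Fc: "F p r 0 0 $ (a1, i) = c (Some i)" "F p r 0 0 $ (a2, i) = 0" for i
                by (simp_all add: F1 F2 p_def r_def complex_eq_iff)
              show ?thesis
                by (simp add: mult_axis) (simp add: matrix_vector_mult_def sum_UNIV_prod sum_m Fc mult.commute)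
            qed
            then show ?thesis by (simp add: vec_eq_iff)
          qed
          finally show ?thesis .
        qed
        have z: "c None * F 0 0 u v $ k + (W *v F p r 0 0) $ k = 0" for k
          using 0 unfolding s by (metis vector_add_component vector_smult_component zero_index)
        have "Complex ((A *v p) $ i) ((A *v r) $ i) = 0" for i
          using z[of "(a1, i)"] by (simp add: WF F1 complex_eq_iff)
        then have "A *v p = 0" "A *v r = 0" by (simp_all add: vec_eq_iff complex_eq_iff)
        then have pr: "p = 0" "r = 0" using injA by auto
        have "F p r 0 0 = 0" using pr F_eq_0 by simp
        then have "c None * F 0 0 u v $ k = 0" for k using z[of k] by simp
        then have "c None = 0" using g(2) by (auto simp: vec_eq_iff)
        moreover have "c (Some i) = 0" for i
          using pr by (simp add: p_def r_def vec_eq_iff complex_eq_iff)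
        ultimately show ?thesis by (metis (full_types) option.exhaust)
      qed
      obtain H where H: "H \<in> tensor Herm Sym" "H \<noteq> 0" "rtrace H = 0" "W + H \<in> Herm_psd" "W - H \<in> Herm_psd"
        using not_extreme_if_rank_four[OF m n Wt Wp indep] by blast
      obtain c where "H = c *\<^sub>R W" using ext[OF H(1,4,5)] by blast
      then show False using H(2,3) rtrace_pos[OF Wp W0] by (simp add: linear_scale[OF linear_rtrace])
    qed
    \<comment> \<open>The imaginary part of the vanishing Schur complement, with the inverse of
      \<open>A\<close> replaced by the solutions \<open>p\<close> and \<open>r\<close>.\<close>
    have comm: "X *v r = Y *v p" if "A *v p = - (X *v z)" "A *v r = - (Y *v z)" for z p r
      using F_indep elim[OF that] F_eq_0 by (metis right_minus_eq)
    obtain x0 \<mu> where x0: "x0 \<noteq> 0" "\<And>e. e \<bullet> (X *v x0) = \<mu> * (e \<bullet> (A *v x0))"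
    proof -
      have "(UNIV :: (real^'n) set) \<noteq> {0}"
      proof
        assume "(UNIV :: (real^'n) set) = {0}"
        then have "(axis (undefined::'n) 1 :: real^'n) \<in> {0}" by blast
        then show False by (simp add: axis_eq_0_iff)
      qed
      from generalized_eigenvector[OF matrix_vector_mul_linear adjA matrix_vector_mul_linear adjX subspace_UNIV this] posA
      show ?thesis using that by blast
    qed
    \<comment> \<open>The eigenspace of \<open>X\<close> relative to \<open>A\<close>. By
      \<open>comm\<close> it is invariant under A^-1 Y, which is shown below only for the vector
      needed, as \<open>rE\<close>.\<close>
    define E where "E = {x. X *v x = \<mu> *\<^sub>R (A *v x)}"
    have "e \<bullet> (X *v x0 - \<mu> *\<^sub>R (A *v x0)) = 0" for e using x0(2)[of e] by (simp add: inner_diff_right)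
    from this[of "X *v x0 - \<mu> *\<^sub>R (A *v x0)"] have "x0 \<in> E" by (simp add: E_def)
    then have Ene: "E \<noteq> {0}" using x0(1) by blast
    have subE: "subspace E" unfolding E_def
      by (auto simp: subspace_def matrix_vector_right_distrib scaleR_add_right linear_scale[OF matrix_vector_mul_linear])
    obtain x \<nu> where x: "x \<in> E" "x \<noteq> 0" "\<And>e. e \<in> E \<Longrightarrow> e \<bullet> (Y *v x) = \<nu> * (e \<bullet> (A *v x))"
      using generalized_eigenvector[OF matrix_vector_mul_linear adjA matrix_vector_mul_linear adjY subE Ene] posA
      by blast
    have Xx: "X *v x = \<mu> *\<^sub>R (A *v x)" using x(1) by (simp add: E_def)
    obtain r where r: "A *v r = - (Y *v x)" using surjA by blast
    have lA: "A *v (c *\<^sub>R u) = c *\<^sub>R (A *v u)" "Y *v (c *\<^sub>R u) = c *\<^sub>R (Y *v u)" for c u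
      by (simp_all add: linear_scale[OF matrix_vector_mul_linear])
    have "A *v ((- \<mu>) *\<^sub>R x) = - (X *v x)" unfolding lA Xx by simp
    from comm[OF this r] have "X *v r = (- \<mu>) *\<^sub>R (Y *v x)" by (simp only: lA)
    then have rE: "r \<in> E" by (simp add: E_def r)
    \<comment> \<open>\<open>e\<close> is \<nu> x - A^-1 Y x. It lies in \<open>E\<close>, and
      testing the weak equation against \<open>e\<close> itself gives
      \<open>e \<bullet> (A *v e) = 0\<close>, so the equation holds exactly.\<close>
    define e where "e = r + \<nu> *\<^sub>R x"
    have eE: "e \<in> E" unfolding e_def by (intro subspace_add subspace_scale subE rE x(1))
    have Ae: "A *v e = - (Y *v x) + \<nu> *\<^sub>R (A *v x)"
      by (simp only: e_def matrix_vector_right_distrib r lA)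
    have "e \<bullet> (A *v e) = 0" unfolding Ae using x(3)[OF eE] by (simp add: inner_diff_right)
    then have "e = 0" using posA[of e] by force
    then have Yx: "Y *v x = \<nu> *\<^sub>R (A *v x)" using Ae by simp
    have "W *v F x 0 0 0 = pvec (\<chi> b. if b = a1 then 1 else Complex \<mu> (- \<nu>)) (A *v x)"
      unfolding WF using a(2) by (intro eqI) (auto simp: F1 F2 Xx Yx complex_eq_iff)
    moreover have "pvec (\<chi> b. if b = a1 then 1 else Complex \<mu> (- \<nu>)) (A *v x) \<noteq> 0"
      using injA[of x] x(2) by (auto simp: pvec_eq_0_iff vec_eq_iff intro!: exI[of _ a1])
    ultimately show ?thesis by blast
  qed
qed

section \<open>Nonseparable positive semidefinite matrices\<close>

lemma kron_mult_pvec: "kron A B *v pvec u y = pvec (A *v u) (B *v y)"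
proof -
  have "(kron A B *v pvec u y) $ (a, i) = pvec (A *v u) (B *v y) $ (a, i)" for a i
    by (simp add: matrix_vector_mult_def sum_UNIV_prod sum_product mult_ac)
  then show ?thesis by (simp add: vec_eq_iff split_paired_all)
qed

lemma cip_psd_kernel:
  assumes "W \<in> Herm_psd" "f \<bullet> (W *v f) = 0"
  shows "cip (W *v g) f = 0"
proof -
  have "W *v f = 0" using psd_kernel assms by blast
  moreover have "(W *v g) \<bullet> h = g \<bullet> (W *v h)" for h
    using inner_mult_Herm Herm_psdD(1)[OF assms(1)] by metis
  ultimately show ?thesis by (simp add: cip_eq_0_iff mult_vector_smult)
qed

lemma sum_mult_vector: "(\<Sum>k<K. V k) *v f = (\<Sum>k<(K::nat). V k *v (f :: complex^'k))"
  by (induction K) (simp_all add: matrix_vector_mult_add_rdistrib)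

text \<open>A nonzero summand of \<open>W\<close> has a nonzero product vector in its range. By
  \<open>kron_psd\<close> all summands have nonnegative forms, so a zero of the form of
  \<open>W\<close> is a zero of the form of this summand.\<close>

lemma separable_product_vector:
  fixes W :: "complex^('m::finite \<times> 'n::finite)^('m \<times> 'n)"
  assumes sep: "separable Herm_psd Sym_psd W" and W0: "W \<noteq> 0"
  obtains z x where "z \<noteq> 0" "x \<noteq> 0" "\<And>f. f \<bullet> (W *v f) = 0 \<Longrightarrow> cip (pvec z x) f = 0"
proof -
  obtain k F G where FG: "\<And>l. l < (k::nat) \<Longrightarrow> F l \<in> Herm_psd" "\<And>l. l < k \<Longrightarrow> G l \<in> Sym_psd"
    and W: "W = (\<Sum>l<k. kron (F l) (G l))"
    using sep unfolding separable_def by blast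
  obtain l where l: "l < k" "kron (F l) (G l) \<noteq> 0"
    using W0 unfolding W by (meson lessThan_iff sum.not_neutral_contains_not_neutral)
  have "F l \<noteq> 0" "G l \<noteq> 0" using l(2) by (auto simp: vec_eq_iff)
  then obtain u y where uy: "F l *v u \<noteq> 0" "G l *v y \<noteq> 0"
    by (metis matrix_eq matrix_vector_mult_0)
  have psd: "kron (F j) (G j) \<in> Herm_psd" if "j < k" for j using kron_psd FG that by blast
  show thesis
  proof (rule that[OF uy])
    fix f assume "f \<bullet> (W *v f) = 0"
    moreover have "f \<bullet> (W *v f) = (\<Sum>j<k. f \<bullet> (kron (F j) (G j) *v f))"
      by (simp add: W sum_mult_vector inner_sum_right)
    ultimately have "f \<bullet> (kron (F l) (G l) *v f) = 0"
      using l(1) Herm_psdD(2)[OF psd] by (intro sum_nonneg_0[of "{..<k}" "\<lambda>j. f \<bullet> (kron (F j) (G j) *v f)"]) auto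
    then show "cip (pvec (F l *v u) (G l *v y)) f = 0"
      using cip_psd_kernel[OF psd[OF l(1)]] by (metis kron_mult_pvec)
  qed
qed

text \<open>Indices are natural numbers, so that a small example extends by zero to all larger sizes. In
  \<open>no_prod\<close>, \<open>Z\<close> is the conjugate of the complex factor.\<close>

lemma exists_nonseparable:
  fixes v :: "nat \<Rightarrow> nat \<Rightarrow> nat \<Rightarrow> complex"
  assumes m0: "m0 \<le> CARD('m::finite)" and n0: "n0 \<le> CARD('n::finite)"
    and supp: "\<And>k a i. v k a i \<noteq> 0 \<Longrightarrow> a < m0 \<and> i < n0"
    and sym: "\<And>a b i j. a < m0 \<Longrightarrow> b < m0 \<Longrightarrow> i < n0 \<Longrightarrow> j < n0 \<Longrightarrow>
      (\<Sum>k<K. v k a i * cnj (v k b j)) = (\<Sum>k<K. v k a j * cnj (v k b i))"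
    and nz: "k0 < K" "v k0 a0 i0 \<noteq> 0"
    and no_prod: "\<And>Z (X :: nat \<Rightarrow> real).
      (\<And>\<phi>. (\<And>k. k < K \<Longrightarrow> (\<Sum>a<m0. \<Sum>i<n0. cnj (v k a i) * \<phi> a i) = 0) \<Longrightarrow>
        (\<Sum>a<m0. \<Sum>i<n0. Z a * of_real (X i) * \<phi> a i) = 0) \<Longrightarrow>
      (\<forall>a<m0. Z a = 0) \<or> (\<forall>i<n0. X i = 0)"
  shows "\<exists>W :: complex^('m \<times> 'n)^('m \<times> 'n). W \<in> tensor Herm Sym \<and> W \<in> Herm_psd \<and>
    \<not> separable Herm_psd Sym_psd W"
proof -
  \<comment> \<open>Both index types are numbered from 0; the first \<open>m0\<close> and
    \<open>n0\<close> indices carry the example.\<close>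
  obtain \<alpha> :: "'m \<Rightarrow> nat" where \<alpha>: "bij_betw \<alpha> UNIV {..<CARD('m)}"
    using ex_bij_betw_finite_nat[of "UNIV :: 'm set"] by (auto simp: atLeast0LessThan)
  obtain \<beta> :: "'n \<Rightarrow> nat" where \<beta>: "bij_betw \<beta> UNIV {..<CARD('n)}"
    using ex_bij_betw_finite_nat[of "UNIV :: 'n set"] by (auto simp: atLeast0LessThan)
  define em :: "(nat \<Rightarrow> nat \<Rightarrow> complex) \<Rightarrow> complex^('m \<times> 'n)"
    where "em \<phi> = (\<chi> p. \<phi> (\<alpha> (fst p)) (\<beta> (snd p)))" for \<phi>
  have em: "em \<phi> $ (a, i) = \<phi> (\<alpha> a) (\<beta> i)" for \<phi> a i by (simp add: em_def)
  have block_sum: "(\<Sum>p\<in>UNIV. h (\<alpha> (fst p)) (\<beta> (snd p))) = (\<Sum>a<m0. \<Sum>i<n0. h a i)"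
    if h: "\<And>a i. h a i \<noteq> 0 \<Longrightarrow> a < m0 \<and> i < n0" for h :: "nat \<Rightarrow> nat \<Rightarrow> complex"
  proof -
    have h0: "h a i = 0" if "\<not> a < m0 \<or> \<not> i < n0" for a i using h that by blast
    have "(\<Sum>p\<in>UNIV. h (\<alpha> (fst p)) (\<beta> (snd p))) = (\<Sum>a\<in>UNIV. \<Sum>i\<in>UNIV. h (\<alpha> a) (\<beta> i))"
      by (simp add: sum_UNIV_prod)
    also have "\<dots> = (\<Sum>a<CARD('m). \<Sum>i<CARD('n). h a i)"
      unfolding sum.reindex_bij_betw[OF \<beta>] by (rule sum.reindex_bij_betw[OF \<alpha>])
    also have "\<dots> = (\<Sum>a<CARD('m). \<Sum>i<n0. h a i)"
    proof (rule sum.cong[OF refl])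
      show "(\<Sum>i<CARD('n). h a i) = (\<Sum>i<n0. h a i)" for a
        using n0 by (intro sum.mono_neutral_right) (auto simp: h0)
    qed
    also have "\<dots> = (\<Sum>a<m0. \<Sum>i<n0. h a i)"
      using m0 by (intro sum.mono_neutral_right) (auto simp: h0)
    finally show ?thesis .
  qed
  define W :: "complex^('m \<times> 'n)^('m \<times> 'n)" where "W = (\<Sum>k<K. outerc (em (v k)))"
  have Wp: "W \<in> Herm_psd" unfolding W_def by (intro psd_sum outerc_psd)
  have Wnth: "W $ (a,i) $ (b,j) = (\<Sum>k<K. v k (\<alpha> a) (\<beta> i) * cnj (v k (\<alpha> b) (\<beta> j)))" for a b i j
    by (simp add: W_def em)
  have qW: "f \<bullet> (W *v f) = (\<Sum>k<K. (cmod (cip (em (v k)) f))\<^sup>2)" for f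
    by (simp add: W_def sum_mult_vector inner_sum_right inner_outerc)
  have Wt: "W \<in> tensor Herm Sym"
    unfolding tensor_iff
  proof (intro conjI allI)
    show "W \<in> Herm" using Wp by (rule Herm_psdD)
    fix a b i j
    have z: "v k a' i' = 0" if "\<not> (a' < m0 \<and> i' < n0)" for k a' i' using supp that by blast
    show "W $ (a, i) $ (b, j) = W $ (a, j) $ (b, i)"
    proof (cases "\<alpha> a < m0 \<and> \<alpha> b < m0 \<and> \<beta> i < n0 \<and> \<beta> j < n0")
      case True
      then show ?thesis using sym unfolding Wnth by blast
    next
      case False
      then have prod0: "v k (\<alpha> a) (\<beta> i) * cnj (v k (\<alpha> b) (\<beta> j)) = 0" "v k (\<alpha> a) (\<beta> j) * cnj (v k (\<alpha> b) (\<beta> i)) = 0" for k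
        using z by auto
      show ?thesis unfolding Wnth by (simp only: prod0)
    qed
  qed
  have "\<not> separable Herm_psd Sym_psd W"
  proof
    assume sep: "separable Herm_psd Sym_psd W"
    obtain a1 i1 where ai: "\<alpha> a1 = a0" "\<beta> i1 = i0"
    proof -
      have "a0 \<in> \<alpha> ` UNIV" "i0 \<in> \<beta> ` UNIV"
        using supp[OF nz(2)] m0 n0 bij_betw_imp_surj_on[OF \<alpha>] bij_betw_imp_surj_on[OF \<beta>] by auto
      then show thesis using that by blast
    qed
    have cip_axis: "cip w (axis p 1) = cnj (w $ p)" for w :: "complex^('m \<times> 'n)" and p
      by (simp add: cip_def axis_def if_distrib cong: if_cong)
    have "W \<noteq> 0"
    proof
      assume "W = 0"
      then have "(\<Sum>k<K. (cmod (cip (em (v k)) (axis (a1, i1) 1)))\<^sup>2) = 0" using qW by (metis inner_zero_right matrix_vector_mult_0)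
      then have "cip (em (v k0)) (axis (a1, i1) 1) = 0" using nz(1) by (simp add: sum_nonneg_eq_0_iff)
      then show False using nz(2) ai by (simp add: cip_axis em)
    qed
    from separable_product_vector[OF sep this]
    obtain z x where zx: "z \<noteq> 0" "x \<noteq> 0" "\<And>f. f \<bullet> (W *v f) = 0 \<Longrightarrow> cip (pvec z x) f = 0" by metis
    \<comment> \<open>The form of \<open>W\<close> vanishes at basis vectors outside the block, so
      the product vector has zero entries there.\<close>
    have out: "z $ a = 0 \<or> x $ i = 0" if "\<not> (\<alpha> a < m0 \<and> \<beta> i < n0)" for a i
    proof -
      have "v k (\<alpha> a) (\<beta> i) = 0" for k using supp that by blast
      then have "axis (a, i) 1 \<bullet> (W *v axis (a, i) 1) = 0" by (simp add: qW cip_axis em)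
      from zx(3)[OF this] show ?thesis by (simp add: cip_axis)
    qed
    define Z where "Z a = cnj (z $ inv_into UNIV \<alpha> a)" for a
    define X where "X i = x $ inv_into UNIV \<beta> i" for i
    have Z: "Z (\<alpha> a) = cnj (z $ a)" for a using \<alpha> by (simp add: Z_def bij_betw_def)
    have X: "X (\<beta> i) = x $ i" for i using \<beta> by (simp add: X_def bij_betw_def)
    have "(\<forall>a<m0. Z a = 0) \<or> (\<forall>i<n0. X i = 0)"
    proof (rule no_prod)
      fix \<phi> assume ker: "\<And>k. k < K \<Longrightarrow> (\<Sum>a<m0. \<Sum>i<n0. cnj (v k a i) * \<phi> a i) = 0"
      \<comment> \<open>Truncation makes \<open>block_sum\<close> applicable and leaves the sums
        over the block unchanged.\<close>
      define \<psi> where "\<psi> a i = (if a < m0 \<and> i < n0 then \<phi> a i else 0)" for a i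
      have "cip (em (v k)) (em \<psi>) = 0" if "k < K" for k
      proof -
        have "cip (em (v k)) (em \<psi>) = (\<Sum>p\<in>UNIV. cnj (v k (\<alpha> (fst p)) (\<beta> (snd p))) * \<psi> (\<alpha> (fst p)) (\<beta> (snd p)))"
          by (simp add: cip_def em_def)
        also have "\<dots> = (\<Sum>a<m0. \<Sum>i<n0. cnj (v k a i) * \<psi> a i)"
          by (rule block_sum) (use supp in auto)
        finally show ?thesis using ker[OF that] by (simp add: \<psi>_def)
      qed
      then have "cip (pvec z x) (em \<psi>) = 0" by (intro zx(3)) (simp add: qW)
      moreover have "cip (pvec z x) (em \<psi>) =
          (\<Sum>p\<in>UNIV. Z (\<alpha> (fst p)) * of_real (X (\<beta> (snd p))) * \<psi> (\<alpha> (fst p)) (\<beta> (snd p)))"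
        by (simp add: cip_def em_def Z X pvec_def)
      moreover have "\<dots> = (\<Sum>a<m0. \<Sum>i<n0. Z a * of_real (X i) * \<psi> a i)"
        by (rule block_sum) (auto simp: \<psi>_def split: if_splits)
      ultimately show "(\<Sum>a<m0. \<Sum>i<n0. Z a * of_real (X i) * \<phi> a i) = 0" by (simp add: \<psi>_def)
    qed
    then show False
    proof
      assume "\<forall>a<m0. Z a = 0"
      then have za: "z $ a = 0" if "\<alpha> a < m0" for a using Z[of a] that by simp
      \<comment> \<open>This nonzero entry lies outside the block, where \<open>out\<close> forces
        all of \<open>x\<close> to vanish.\<close>
      obtain a where "z $ a \<noteq> 0" using zx(1) by (auto simp: vec_eq_iff)
      then have "x $ i = 0" for i using za out by blast
      then show False using zx(2) by (auto simp: vec_eq_iff)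
    next
      assume "\<forall>i<n0. X i = 0"
      then have xi: "x $ i = 0" if "\<beta> i < n0" for i using X[of i] that by simp
      obtain i where "x $ i \<noteq> 0" using zx(2) by (auto simp: vec_eq_iff)
      then have "z $ a = 0" for a using xi out by blast
      then show False using zx(1) by (auto simp: vec_eq_iff)
    qed
  qed
  then show ?thesis using Wt Wp by blast
qed

text \<open>The value 0 outside the block gives the support condition of
  \<open>exists_nonseparable\<close>.\<close>

definition tab :: "complex list list list \<Rightarrow> nat \<Rightarrow> nat \<Rightarrow> nat \<Rightarrow> nat \<Rightarrow> nat \<Rightarrow> complex" where
  "tab L m n k a i = (if a < m \<and> i < n then L ! k ! a ! i else 0)"

text \<open>The conditions for \<open>z \<otimes> x\<close> to be orthogonal to the kernel in the case \<open>m = 2\<close>, \<open>n = 4\<close>,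
  with \<open>p + \<i> q\<close> the ratio of the two entries of the conjugate of \<open>z\<close>.\<close>

lemma two_four_real_system:
  fixes p q x0 x1 x2 x3 :: real
  assumes "x0 = p * x2" "x1 = - (3 * q * x2)" "2 * x1 = p * x3" "2 * x0 = - (3 * q * x3)"
    and "3 * p * x1 = 8 * x3 + 3 * q * x0" "3 * p * x0 + 3 * q * x1 = 2 * x2"
  shows "x0 = 0 \<and> x1 = 0 \<and> x2 = 0 \<and> x3 = 0"
proof -
  have e3: "x3 * (3 * p^2 + 9 * q^2 - 16) = 0"
  proof -
    have "x3 * (3 * p^2 + 9 * q^2 - 16) = 3 * p * (p * x3) - 3 * q * (- (3 * q * x3)) - 16 * x3"
      by (simp add: power2_eq_square algebra_simps)
    then show ?thesis using assms(5) by (simp flip: assms(3,4))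
  qed
  have e2: "x2 * (3 * p^2 - 9 * q^2 - 2) = 0"
    using assms(6) by (simp add: assms(1,2) power2_eq_square algebra_simps)
  \<comment> \<open>Two expressions each for \<open>2 * x0\<close> and \<open>2 * x1\<close>.
    Multiplied together they give \<open>p^2 = 9 * q^2\<close> unless \<open>x2\<close> or
    \<open>x3\<close> is 0.\<close>
  have c1: "2 * (p * x2) = - (3 * q * x3)" using assms(1,4) by simp
  have c2: "- (6 * q * x2) = p * x3" using assms(2,3) by simp
  have "x2 = 0 \<and> x3 = 0"
  proof (rule ccontr)
    assume n: "\<not> (x2 = 0 \<and> x3 = 0)"
    have "x2 * (x3 * (p^2 - 9 * q^2)) = 0"
    proof -
      have "2 * (p * x2) * (p * x3) = (- (3 * q * x3)) * (- (6 * q * x2))" using c1 c2 by simp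
      then show ?thesis by (simp add: power2_eq_square algebra_simps)
    qed
    then consider "x2 = 0" "x3 \<noteq> 0" | "x3 = 0" "x2 \<noteq> 0" | "x2 \<noteq> 0" "x3 \<noteq> 0" "p^2 = 9 * q^2" using n by auto
    then show False
    proof cases
      case 1 then show False using c1 c2 e3 by simp
    next
      case 2 then show False using c1 c2 e2 by simp
    next
      case 3
      \<comment> \<open>With \<open>p^2 = 9 * q^2\<close> these would give both 4/9 and 1/9 for
        \<open>q^2\<close>.\<close>
      then have "3 * p^2 + 9 * q^2 = 16" "3 * p^2 - 9 * q^2 = 2" using e2 e3 by auto
      then show False using 3(3) by linarith
    qed
  qed
  then show ?thesis using assms(1,2) by simp
qed

text \<open>After division by \<open>Z0\<close> the real and imaginary parts separate because the
  \<open>x\<close> are real: three complex equations become six real ones.\<close>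

lemma two_four_system:
  fixes Z0 Z1 :: complex and x0 x1 x2 x3 :: real
  assumes E1: "Z0 * x0 * (-3) + Z0 * x1 * \<i> + Z1 * x2 * 3 = 0"
    and E2: "Z0 * x0 * (2 * \<i>) + Z0 * x1 * (-6) + Z1 * x3 * 3 = 0"
    and E3: "Z0 * x2 * (-2 * \<i>) + Z0 * x3 * (-8) + Z1 * x0 * (3 * \<i>) + Z1 * x1 * 3 = 0"
  shows "(Z0 = 0 \<and> Z1 = 0) \<or> (x0 = 0 \<and> x1 = 0 \<and> x2 = 0 \<and> x3 = 0)"
proof (cases "Z0 = 0")
  case True
  show ?thesis
  proof (cases "Z1 = 0")
    case False
    have "Z1 * (x0 * (3 * \<i>) + x1 * 3) = 0" using E3 True by (simp add: algebra_simps)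
    then have "x0 * (3 * \<i>) + x1 * 3 = 0" using False by simp
    then have "x0 = 0 \<and> x1 = 0" by (simp add: complex_eq_iff)
    then show ?thesis using E1 E2 True False by simp
  qed (use True in simp)
next
  case False
  define t where "t = Z1 / Z0"
  have Z1: "Z1 = Z0 * t" using False by (simp add: t_def)
  have "Z0 * (x0 * (-3) + x1 * \<i> + t * x2 * 3) = 0" using E1 by (simp add: Z1 algebra_simps)
  then have e1: "x0 * (-3) + x1 * \<i> + t * x2 * 3 = 0" using False by simp
  have "Z0 * (x0 * (2 * \<i>) + x1 * (-6) + t * x3 * 3) = 0" using E2 by (simp add: Z1 algebra_simps)
  then have e2: "x0 * (2 * \<i>) + x1 * (-6) + t * x3 * 3 = 0" using False by simp
  have "Z0 * (x2 * (-2 * \<i>) + x3 * (-8) + t * x0 * (3 * \<i>) + t * x1 * 3) = 0"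
    using E3 by (simp add: Z1 algebra_simps)
  then have e3: "x2 * (-2 * \<i>) + x3 * (-8) + t * x0 * (3 * \<i>) + t * x1 * 3 = 0" using False by simp
  have "x0 = 0 \<and> x1 = 0 \<and> x2 = 0 \<and> x3 = 0"
    by (rule two_four_real_system[of _ "Re t" _ _ "Im t"])
       (use e1 e2 e3 in \<open>simp_all add: complex_eq_iff algebra_simps\<close>)
  then show ?thesis by blast
qed

lemma exists_nonseparable_two_four:
  assumes "2 \<le> CARD('m::finite)" "4 \<le> CARD('n::finite)"
  shows "\<exists>W :: complex^('m \<times> 'n)^('m \<times> 'n). W \<in> tensor Herm Sym \<and> W \<in> Herm_psd \<and>
    \<not> separable Herm_psd Sym_psd W"
proof -
  \<comment> \<open>The sum of squares is \<open>|3y1 + 3y3' - 2\<i> y4'|\<^sup>2 + |3y2 - \<i> y3' + 6y4'|\<^sup>2 + |3y3 + 3y1' - \<i> y2'|\<^sup>2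
    + |3y4 - 2\<i> y1' + 6y2'|\<^sup>2 + 9|y1' - \<i> y2'|\<^sup>2\<close> in the two rows \<open>y\<close>, \<open>y'\<close>; the lists hold the conjugate coefficients.\<close>
  define L :: "complex list list list" where
    "L = [[[3,0,0,0],[0,0,3,2*\<i>]], [[0,3,0,0],[0,0,\<i>,6]], [[0,0,3,0],[3,\<i>,0,0]],
          [[0,0,0,3],[2*\<i>,6,0,0]], [[0,0,0,0],[3,3*\<i>,0,0]]]"
  note ev = eval_nat_numeral tab_def L_def
  show ?thesis
  proof (rule exists_nonseparable[OF assms, of "tab L 2 4" 5 0 0 0])
    show "tab L 2 4 k a i \<noteq> 0 \<Longrightarrow> a < 2 \<and> i < 4" for k a i by (auto simp: tab_def split: if_splits)
    show "(0::nat) < 5" "tab L 2 4 0 0 0 \<noteq> 0" by (simp_all add: ev)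
    fix a b i j :: nat
    assume "a < 2" "b < 2" "i < 4" "j < 4"
    then have "a \<in> {0, 1}" "b \<in> {0, 1}" "i \<in> {0, 1, 2, 3}" "j \<in> {0, 1, 2, 3}" by auto
    then show "(\<Sum>k<5. tab L 2 4 k a i * cnj (tab L 2 4 k b j)) = (\<Sum>k<5. tab L 2 4 k a j * cnj (tab L 2 4 k b i))"
      by (elim insertE emptyE; simp add: ev)
  next
    fix Z :: "nat \<Rightarrow> complex" and X :: "nat \<Rightarrow> real"
    assume ann: "\<And>\<phi>. (\<And>k. k < 5 \<Longrightarrow> (\<Sum>a<2. \<Sum>i<4. cnj (tab L 2 4 k a i) * \<phi> a i) = 0) \<Longrightarrow>
        (\<Sum>a<2. \<Sum>i<4. Z a * of_real (X i) * \<phi> a i) = 0"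
    \<comment> \<open>Test vectors are given as lists, so that lying in the kernel is a finite
      computation. The three used below span the 3-dimensional common kernel of the five
      squares.\<close>
    have ann': "(\<Sum>a<2. \<Sum>i<4. Z a * of_real (X i) * P ! a ! i) = 0"
      if "\<forall>k\<in>{0, 1, 2, 3, 4}. (\<Sum>a<2. \<Sum>i<4. cnj (tab L 2 4 k a i) * P ! a ! i) = 0" for P
      by (rule ann, rule bspec[OF that]) auto
    have "Z 0 * X 0 * (-3) + Z 0 * X 1 * \<i> + Z 1 * X 2 * 3 = 0"
      using ann'[of "[[-3, \<i>, 0, 0], [0, 0, 3, 0]]"] by (simp add: ev)
    moreover have "Z 0 * X 0 * (2 * \<i>) + Z 0 * X 1 * (-6) + Z 1 * X 3 * 3 = 0"
      using ann'[of "[[2 * \<i>, -6, 0, 0], [0, 0, 0, 3]]"] by (simp add: ev)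
    moreover have "Z 0 * X 2 * (-2 * \<i>) + Z 0 * X 3 * (-8) + Z 1 * X 0 * (3 * \<i>) + Z 1 * X 1 * 3 = 0"
      using ann'[of "[[0, 0, -2 * \<i>, -8], [3 * \<i>, 3, 0, 0]]"] by (simp add: ev add.assoc)
    ultimately have "(Z 0 = 0 \<and> Z 1 = 0) \<or> (X 0 = 0 \<and> X 1 = 0 \<and> X 2 = 0 \<and> X 3 = 0)"
      by (rule two_four_system)
    then show "(\<forall>a<2. Z a = 0) \<or> (\<forall>i<4. X i = 0)"
      by (auto simp: eval_nat_numeral less_Suc_eq)
  qed
qed

text \<open>Unextendibility of the Tiles basis: the equations say that all five basis vectors
  annihilate the product of \<open>Z\<close> and \<open>x\<close>. The case split decides which of
  them can be cancelled.\<close>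

lemma tiles_system:
  fixes Z0 Z1 Z2 x0 x1 x2 :: complex
  assumes "Z0 * x0 = Z0 * x1" "Z2 * x1 = Z2 * x2" "Z0 * x2 = Z1 * x2" "Z1 * x0 = Z2 * x0"
    and "(Z0 + Z1 + Z2) * (x0 + x1 + x2) = 0"
  shows "(Z0 = 0 \<and> Z1 = 0 \<and> Z2 = 0) \<or> (x0 = 0 \<and> x1 = 0 \<and> x2 = 0)"
proof -
  consider "Z0 = 0" "Z2 = 0" | "Z0 = 0" "Z2 \<noteq> 0" | "Z0 \<noteq> 0" "Z2 = 0" | "Z0 \<noteq> 0" "Z2 \<noteq> 0" by blast
  then show ?thesis using assms by cases auto
qed

lemma exists_nonseparable_three_three:
  assumes "3 \<le> CARD('m::finite)" "3 \<le> CARD('n::finite)"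
  shows "\<exists>W :: complex^('m \<times> 'n)^('m \<times> 'n). W \<in> tensor Herm Sym \<and> W \<in> Herm_psd \<and>
    \<not> separable Herm_psd Sym_psd W"
proof -
  \<comment> \<open>With \<open>s1\<close>, \<open>s2\<close>, \<open>s3\<close>, \<open>s4\<close> the sums over the four dominoes of the Tiles pattern, \<open>c\<close> the central entry
    and \<open>S = s1 + s2 + s3 + s4\<close>, 72 times the projection onto the complement of the Tiles basis is
    \<open>18|s1 - s2|\<^sup>2 + 18|s3 - s4|\<^sup>2 + 9|s1 + s2 - s3 - s4|\<^sup>2 + |S - 8c|\<^sup>2\<close>; the repeated rows avoid \<open>sqrt 2\<close>.\<close>
  define L :: "complex list list list" where
    "L = [[[3,3,0],[0,0,0],[0,-3,-3]], [[3,3,0],[0,0,0],[0,-3,-3]],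
          [[0,0,3],[-3,0,3],[-3,0,0]], [[0,0,3],[-3,0,3],[-3,0,0]],
          [[3,3,-3],[-3,0,-3],[-3,3,3]], [[1,1,1],[1,-8,1],[1,1,1]]]"
  note ev = eval_nat_numeral tab_def L_def
  show ?thesis
  proof (rule exists_nonseparable[OF assms, of "tab L 3 3" 6 0 0 0])
    show "tab L 3 3 k a i \<noteq> 0 \<Longrightarrow> a < 3 \<and> i < 3" for k a i by (auto simp: tab_def split: if_splits)
    show "(0::nat) < 6" "tab L 3 3 0 0 0 \<noteq> 0" by (simp_all add: ev)
    fix a b i j :: nat
    assume "a < 3" "b < 3" "i < 3" "j < 3"
    then have "a \<in> {0, 1, 2}" "b \<in> {0, 1, 2}" "i \<in> {0, 1, 2}" "j \<in> {0, 1, 2}" by auto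
    then show "(\<Sum>k<6. tab L 3 3 k a i * cnj (tab L 3 3 k b j)) = (\<Sum>k<6. tab L 3 3 k a j * cnj (tab L 3 3 k b i))"
      by (elim insertE emptyE; simp add: ev)
  next
    fix Z :: "nat \<Rightarrow> complex" and X :: "nat \<Rightarrow> real"
    assume ann: "\<And>\<phi>. (\<And>k. k < 6 \<Longrightarrow> (\<Sum>a<3. \<Sum>i<3. cnj (tab L 3 3 k a i) * \<phi> a i) = 0) \<Longrightarrow>
        (\<Sum>a<3. \<Sum>i<3. Z a * of_real (X i) * \<phi> a i) = 0"
    have ann': "(\<Sum>a<3. \<Sum>i<3. Z a * of_real (X i) * P ! a ! i) = 0"
      if "\<forall>k\<in>{0, 1, 2, 3, 4, 5}. (\<Sum>a<3. \<Sum>i<3. cnj (tab L 3 3 k a i) * P ! a ! i) = 0" for P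
      by (rule ann, rule bspec[OF that]) auto
    \<comment> \<open>The five test vectors from here on are the Tiles basis up to scaling: four
      domino vectors and the all-ones vector.\<close>
    have "Z 0 * X 0 = Z 0 * X 1"
      using ann'[of "[[1, -1, 0], [0, 0, 0], [0, 0, 0]]"] by (simp add: ev)
    moreover have "Z 2 * X 1 = Z 2 * X 2"
      using ann'[of "[[0, 0, 0], [0, 0, 0], [0, 1, -1]]"] by (simp add: ev)
    moreover have "Z 0 * X 2 = Z 1 * X 2"
      using ann'[of "[[0, 0, 1], [0, 0, -1], [0, 0, 0]]"] by (simp add: ev)
    moreover have "Z 1 * X 0 = Z 2 * X 0"
      using ann'[of "[[0, 0, 0], [1, 0, 0], [-1, 0, 0]]"] by (simp add: ev)
    moreover have "(Z 0 + Z 1 + Z 2) * (complex_of_real (X 0) + X 1 + X 2) = 0"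
      using ann'[of "[[1, 1, 1], [1, 1, 1], [1, 1, 1]]"] by (simp add: ev algebra_simps)
    ultimately have "(Z 0 = 0 \<and> Z 1 = 0 \<and> Z 2 = 0) \<or>
        (complex_of_real (X 0) = 0 \<and> complex_of_real (X 1) = 0 \<and> complex_of_real (X 2) = 0)"
      by (rule tiles_system)
    then show "(\<forall>a<3. Z a = 0) \<or> (\<forall>i<3. X i = 0)"
      by (auto simp: eval_nat_numeral less_Suc_eq)
  qed
qed

section \<open>The sizes for which separability and positivity agree\<close>

theorem theorem8p1:
  shows "{X \<in> tensor (Herm :: (complex^'m::finite^'m) set) (Sym :: (real^'n::finite^'n) set).
            separable Herm_psd Sym_psd X}
       = {X \<in> tensor Herm Sym. X \<in> Herm_psd}
     \<longleftrightarrow> CARD('n) \<le> 2 \<or> CARD('m) = 1 \<or> CARD('m) + CARD('n) \<le> 5"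
  (is "?L = ?R \<longleftrightarrow> ?C")
proof
  assume eq: "?L = ?R"
  show ?C
  proof (rule ccontr)
    assume "\<not> ?C"
    moreover have "0 < CARD('m)" "0 < CARD('n)" by simp_all
    \<comment> \<open>The sizes violating \<open>?C\<close> are exactly those that dominate (2, 4)
      or (3, 3).\<close>
    ultimately have "2 \<le> CARD('m) \<and> 4 \<le> CARD('n) \<or> 3 \<le> CARD('m) \<and> 3 \<le> CARD('n)" by linarith
    then obtain W :: "complex^('m \<times> 'n)^('m \<times> 'n)"
      where "W \<in> tensor Herm Sym" "W \<in> Herm_psd" "\<not> separable Herm_psd Sym_psd W"
      using exists_nonseparable_two_four[where 'm = 'm and 'n = 'n]
        exists_nonseparable_three_three[where 'm = 'm and 'n = 'n] by blast
    then show False using eq by blast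
  qed
next
  assume C: ?C
  have range: "\<exists>z x f. pvec z x \<noteq> 0 \<and> W *v f = pvec z x"
    if W: "W \<in> tensor Herm Sym" "W \<in> Herm_psd" "W \<noteq> 0"
      and ext: "\<And>H. H \<in> tensor Herm Sym \<Longrightarrow> W + H \<in> Herm_psd \<Longrightarrow> W - H \<in> Herm_psd \<Longrightarrow> \<exists>c. H = c *\<^sub>R W"
    for W :: "complex^('m \<times> 'n)^('m \<times> 'n)"
  proof -
    have "0 < CARD('m)" by simp
    \<comment> \<open>If m > 1 and n > 2, the bound on m + n leaves only the pair (2, 3).\<close>
    with C consider "CARD('n) \<le> 2" | "CARD('m) = 1" | "CARD('m) = 2" "CARD('n) = 3" by linarith
    then show ?thesis
    proof cases
      case 1
      then show ?thesis
        by (intro product_vector_in_two_dim_range[OF W subspace_UNIV]) simp_all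
    next
      case 2
      then show ?thesis using W by (intro product_vector_in_range_card_one)
    next
      case 3
      then show ?thesis using W ext by (rule product_vector_in_range_two_three)
    qed
  qed
  show "?L = ?R" using separable_psd psd_tensor_separable[OF _ _ range] by blast
qed

end
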